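(* Except for a countable number of $\beta>0$, the following condition of non resonance holds: for all $n,n^*,m\in\mathbf N$, all $k,k^*\in\mathbf Z$ and all $j,j^*,\ell\in\{-1,0,1\}$, the equality $$\tau(n,k,j)+\tau(n^*,k^*,j^* )=\tau(m,k+k^*,\ell)$$ implies that either $\tau(n,k,j)=0$, or $\tau(n^*,k^*,j^* )=0$, or $\tau(m,k+k^*,\ell)=0$, or $\tau(n,k,j),\ \tau(n^*,k^*,j^* ),\ \tau(m,k+k^*,\ell)$ all belong to $\mathfrak S_K$, meaning that, among the ageostrophic modes (those with $\tau\ne0$), only three Kelvin waves (modes with $n=0$, $j=0$, $k\neq 0$) may interact.
   Context: For $\beta>0$, the numbers $\tau(n,k,j)$, $(n,k,j)\in\mathbf N\times\mathbf Z\times\{-1,0,1\}$, are defined as follows ($i\tau(n,k,j)$ are the eigenvalues of the operator $L(\eta,u)=(\nabla\cdot u,\beta x_1u^\perp+\nabla\eta)$, $u^\perp=(u_2,-u_1)$, on $L^2(\mathbf R\times\mathbf T)$, $\mathbf T=\mathbf R/2\pi\mathbf Z$). For $n\ge1$ and $k\in\mathbf Z$, $\tau(n,k,-1)<\tau(n,k,0)<\tau(n,k,1)$ are the three distinct real roots of $$\tau^3-(k^2+\beta(2n+1))\tau-\beta k=0 ;$$ for $n=0$, $\tau(0,k,0)=k$ (Kelvin modes, for $k\neq0$) and $\tau(0,k,\pm1)=\frac k2\pm\frac12\sqrt{k^2+4\beta}$. The set of Kelvin eigenvalues is $\mathfrak S_K=\{\tau(0,k,0):k\in\mathbf Z\setminus\{0\}\}=\mathbf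 Z\setminus\{0\}$. *)

theory Defs
  imports Complex_Main "HOL-Library.Countable_Set" "HOL-Computational_Algebra.Polynomial"
begin

definition tau_poly :: "real \<Rightarrow> nat \<Rightarrow> int \<Rightarrow> real poly" where
  "tau_poly \<beta> n k =
     [: - (\<beta> * of_int k), - ((of_int k)\<^sup>2 + \<beta> * (2 * of_nat n + 1)), 0, 1 :]"

text \<open>
  For \<open>n \<ge> 1\<close> the roots are listed in increasing order, so the indices \<open>j = -1, 0, 1\<close> are
  the positions \<open>0, 1, 2\<close>. The lemma \<open>tau_roots\<close> below shows that, for \<open>\<beta> > 0\<close>, there are exactly
  three real roots. For \<open>n = 0\<close> the factor \<open>j / 2\<close> is the sign \<open>\<plusminus>1/2\<close>. Values at \<open>j\<close> outside
  \<open>{-1, 0, 1}\<close> are meaningless and never used.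
\<close>

definition tau :: "real \<Rightarrow> nat \<Rightarrow> int \<Rightarrow> int \<Rightarrow> real" where
  "tau \<beta> n k j =
     (if n \<ge> 1 then sorted_list_of_set {x. poly (tau_poly \<beta> n k) x = 0} ! nat (j + 1)
      else if j = 0 then of_int k
      else of_int k / 2 + of_int j / 2 * sqrt ((of_int k)\<^sup>2 + 4 * \<beta>))"

lemma poly_tau_poly:
  "poly (tau_poly \<beta> n k) x
     = x ^ 3 - ((of_int k)\<^sup>2 + \<beta> * (2 * of_nat n + 1)) * x - \<beta> * of_int k"
  by (simp add: tau_poly_def algebra_simps power2_eq_square power3_eq_cube)

lemma tau_roots:
  assumes "\<beta> > 0" and "n \<ge> 1"
  shows "tau \<beta> n k (-1) < tau \<beta> n k 0" and "tau \<beta> n k 0 < tau \<beta> n k 1"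
    and "{x. poly (tau_poly \<beta> n k) x = 0} = {tau \<beta> n k (-1), tau \<beta> n k 0, tau \<beta> n k 1}"
proof -
  define p where "p = tau_poly \<beta> n k"
  define q where "q = \<beta> * real_of_int k"
  define P where "P = (real_of_int k)\<^sup>2 + \<beta> * (2 * real n + 1)"
  define K where "K = (real_of_int k)\<^sup>2"
  define s where "s = sqrt (P / 3)"
  have K0: "K \<ge> 0" by (simp add: K_def)
  have "\<beta> * 3 \<le> \<beta> * (2 * real n + 1)"
    using assms by (intro mult_left_mono) auto
  then have PK: "P \<ge> K + 3 * \<beta>" by (simp add: P_def K_def)
  then have P0: "P > 0" using K0 assms by linarith
  have s0: "s > 0" and s2: "s\<^sup>2 = P / 3" using P0 by (simp_all add: s_def)
  have ev: "poly p x = x ^ 3 - 3 * s\<^sup>2 * x - q" for x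
    by (simp add: p_def poly_tau_poly q_def s2 P_def)
  have "(2 * s ^ 3)\<^sup>2 = 4 * (s\<^sup>2) ^ 3" by (simp add: power2_eq_square power3_eq_cube)
  also have "\<dots> = 4 / 27 * P ^ 3" by (simp add: s2 power_divide)
  finally have S: "(2 * s ^ 3)\<^sup>2 = 4 / 27 * P ^ 3" .
  have "(K + 3 * \<beta>) ^ 3 = K ^ 3 + 9 * K\<^sup>2 * \<beta> + 27 * (K * \<beta>\<^sup>2) + 27 * \<beta> ^ 3"
    by (simp add: algebra_simps power2_eq_square power3_eq_cube)
  moreover have "K ^ 3 \<ge> 0" "K\<^sup>2 * \<beta> \<ge> 0" "K * \<beta>\<^sup>2 \<ge> 0" "\<beta> ^ 3 > 0" using K0 assms by auto
  moreover have "(K + 3 * \<beta>) ^ 3 \<le> P ^ 3"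
    using PK K0 assms by (intro power_mono) auto
  ultimately have "27 * (K * \<beta>\<^sup>2) < 4 * P ^ 3" by linarith
  moreover have "q\<^sup>2 = K * \<beta>\<^sup>2" by (simp add: q_def K_def power_mult_distrib)
  ultimately have "q\<^sup>2 < (2 * s ^ 3)\<^sup>2" unfolding S by linarith
  then have "\<bar>q\<bar> < \<bar>2 * s ^ 3\<bar>"
    by (metis abs_le_square_iff linorder_not_le)
  then have q: "\<bar>q\<bar> < 2 * s ^ 3" using s0 by simp
  have v: "poly p (-2 * s) < 0" "poly p (-s) > 0" "poly p s < 0" "poly p (2 * s) > 0"
    using q by (simp_all add: ev power2_eq_square power3_eq_cube)
  obtain a where a: "-2 * s < a" "a < -s" "poly p a = 0"
    using poly_IVT_pos[of "-2 * s" "-s" p] v s0 by auto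
  obtain b where b: "-s < b" "b < s" "poly p b = 0"
    using poly_IVT_neg[of "-s" s p] v s0 by auto
  obtain c where c: "s < c" "c < 2 * s" "poly p c = 0"
    using poly_IVT_pos[of s "2 * s" p] v s0 by auto
  have abc: "a < b" "b < c" using a b c by auto
  have p0: "p \<noteq> 0" and deg: "degree p = 3" by (simp_all add: p_def tau_poly_def)
  have fin: "finite {x. poly p x = 0}" using p0 by (rule poly_roots_finite)
  have "{a, b, c} = {x. poly p x = 0}"
  proof (rule card_seteq[OF fin])
    show "{a, b, c} \<subseteq> {x. poly p x = 0}" using a b c by auto
    have "card {x. poly p x = 0} \<le> 3" using card_poly_roots_bound[OF p0] deg by simp
    then show "card {x. poly p x = 0} \<le> card {a, b, c}" using abc by simp
  qed
  then have R: "{x. poly (tau_poly \<beta> n k) x = 0} = {a, b, c}" by (simp add: p_def)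
  have "sorted_list_of_set {a, b, c} = [a, b, c]"
    using abc sorted_list_of_set.idem_if_sorted_distinct[of "[a, b, c]"] by simp
  then have t: "tau \<beta> n k (-1) = a" "tau \<beta> n k 0 = b" "tau \<beta> n k 1 = c"
    using assms by (simp_all add: tau_def R numeral_2_eq_2)
  show "tau \<beta> n k (-1) < tau \<beta> n k 0" "tau \<beta> n k 0 < tau \<beta> n k 1"
    "{x. poly (tau_poly \<beta> n k) x = 0} = {tau \<beta> n k (-1), tau \<beta> n k 0, tau \<beta> n k 1}"
    using abc R by (simp_all add: t)
qed

definition kelvin_spectrum :: "real \<Rightarrow> real set" where
  "kelvin_spectrum \<beta> = {tau \<beta> 0 k 0 | k. k \<noteq> 0}"

definition kelvin_mode :: "nat \<Rightarrow> int \<Rightarrow> int \<Rightarrow> bool" where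
  "kelvin_mode n k j \<longleftrightarrow> n = 0 \<and> j = 0 \<and> k \<noteq> 0"

definition non_resonance :: "real \<Rightarrow> bool" where
  "non_resonance \<beta> \<longleftrightarrow>
    (\<forall>n n' m :: nat. \<forall>k k' :: int. \<forall>j \<in> {-1, 0, 1}. \<forall>j' \<in> {-1, 0, 1}. \<forall>l \<in> {-1, 0, 1}.
       tau \<beta> n k j + tau \<beta> n' k' j' = tau \<beta> m (k + k') l \<longrightarrow>
         tau \<beta> n k j = 0 \<or> tau \<beta> n' k' j' = 0 \<or> tau \<beta> m (k + k') l = 0 \<or>
         (tau \<beta> n k j \<in> kelvin_spectrum \<beta> \<and> tau \<beta> n' k' j' \<in> kelvin_spectrum \<beta> \<and>
          tau \<beta> m (k + k') l \<in> kelvin_spectrum \<beta>))"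

text \<open>
  This is the condition on the modes themselves rather than on their eigenvalues: a priori a
  non-Kelvin mode could have an eigenvalue that happens to be a nonzero integer.
\<close>

definition only_kelvin_interactions :: "real \<Rightarrow> bool" where
  "only_kelvin_interactions \<beta> \<longleftrightarrow>
    (\<forall>n n' m :: nat. \<forall>k k' :: int. \<forall>j \<in> {-1, 0, 1}. \<forall>j' \<in> {-1, 0, 1}. \<forall>l \<in> {-1, 0, 1}.
       tau \<beta> n k j \<noteq> 0 \<and> tau \<beta> n' k' j' \<noteq> 0 \<and> tau \<beta> m (k + k') l \<noteq> 0 \<and>
       tau \<beta> n k j + tau \<beta> n' k' j' = tau \<beta> m (k + k') l \<longrightarrow>
         kelvin_mode n k j \<and> kelvin_mode n' k' j' \<and> kelvin_mode m (k + k') l)"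

end

theory Submission
  imports Defs "HOL-Real_Asymp.Real_Asymp"
begin

text \<open>
  Fix the wave numbers and replace the three labels by all labels in their conjugacy classes (three
  roots of a cubic, two of a quadratic, or one Kelvin root). The product of
  \<open>\<tau>\<^sub>1 + \<tau>\<^sub>2 - \<tau>\<^sub>3\<close> over all these labels is a polynomial in \<open>\<beta>\<close>, so it suffices to show that no
  factor vanishes for large \<open>\<beta>\<close>. There, with \<open>N = 2 n + 1\<close>, a branch is either fast,
  \<open>\<tau> = \<plusminus> sqrt (\<beta> N) + k / (2 N) + o(1)\<close>, or slow,
  \<open>\<tau> = - k x + k\<^sup>3 (x\<^sup>2 - x\<^sup>4) / \<beta> + o(1 / \<beta>)\<close> with \<open>x = 1 / N \<le> 1 / 3\<close>, or \<open>x = -1\<close> for a Kelvin wave.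
  Three fast branches cannot cancel because \<open>N\<close> is odd, and one fast branch cannot cancel
  two slow ones. Two fast branches and a slow one would force \<open>x = - 1 / (2 N)\<close>. For three slow
  branches, the conditions at orders \<open>1\<close> and \<open>1 / \<beta>\<close>, together with \<open>k\<^sub>1 + k\<^sub>2 + k\<^sub>3 = 0\<close>, are only
  compatible with three Kelvin waves.
\<close>

section \<open>Polynomial functions and reduction modulo a root equation\<close>

text \<open>In the uses below \<open>b\<close> is \<open>\<beta>\<close>, the third argument is the
  slot for the root to be eliminated, and \<open>y\<close> carries the sum of the terms still to be
  added. With an inductive definition, elimination of a root is a rule induction.\<close>

inductive polyfun3 :: "(real \<Rightarrow> real \<Rightarrow> real \<Rightarrow> real) \<Rightarrow> bool" where
  const: "polyfun3 (\<lambda>_ _ _. c)"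
| proj1: "polyfun3 (\<lambda>b _ _. b)"
| proj2: "polyfun3 (\<lambda>_ y _. y)"
| proj3: "polyfun3 (\<lambda>_ _ x. x)"
| add: "polyfun3 f \<Longrightarrow> polyfun3 g \<Longrightarrow> polyfun3 (\<lambda>b y x. f b y x + g b y x)"
| mult: "polyfun3 f \<Longrightarrow> polyfun3 g \<Longrightarrow> polyfun3 (\<lambda>b y x. f b y x * g b y x)"

lemma polyfun3_diff:
  assumes "polyfun3 f" and "polyfun3 g"
  shows "polyfun3 (\<lambda>b y x. f b y x - g b y x)"
  using polyfun3.add[OF assms(1) polyfun3.mult[OF polyfun3.const[of "-1"] assms(2)]] by simp

lemma polyfun3_power:
  assumes "polyfun3 f"
  shows "polyfun3 (\<lambda>b y x. f b y x ^ n)"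
  by (induction n) (simp_all add: polyfun3.const polyfun3.mult assms)

lemmas polyfun3_intros = polyfun3.intros polyfun3_diff polyfun3_power

lemma polyfun3_subst:
  assumes "polyfun3 f" and "polyfun3 g" and "polyfun3 h"
  shows "polyfun3 (\<lambda>b y x. f b (g b y x) (h b y x))"
  using assms by induction (auto intro: polyfun3.intros)

lemma polyfun3_imp_poly:
  assumes "polyfun3 f"
  shows "\<exists>p. \<forall>b. f b y x = poly p b"
  using assms
proof induction
  case (const c)
  show ?case by (rule exI[of _ "[:c:]"]) simp
next
  case proj1
  show ?case by (rule exI[of _ "[:0, 1:]"]) simp
next
  case proj2
  show ?case by (rule exI[of _ "[:y:]"]) simp
next
  case proj3
  show ?case by (rule exI[of _ "[:x:]"]) simp
next
  case (add f g)
  then show ?case by (metis poly_add)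
next
  case (mult f g)
  then show ?case by (metis poly_mult)
qed

text \<open>Division with remainder by the quadratic, carried out along the construction of
  \<open>Q\<close>; only the product case creates a square of \<open>r\<close> to be rewritten. The
  same \<open>v\<close> and \<open>w\<close> serve every root \<open>r\<close>, so both conjugates
  can be inserted later.\<close>

lemma polyfun3_reduce_quadratic:
  assumes "polyfun3 Q" and "polyfun3 (\<lambda>b _ _. s b)" and "polyfun3 (\<lambda>b _ _. t b)"
  shows "\<exists>v w. polyfun3 (\<lambda>b y _. v b y) \<and> polyfun3 (\<lambda>b y _. w b y) \<and>
    (\<forall>b y r. r\<^sup>2 = s b * r + t b \<longrightarrow> Q b y r = v b y * r + w b y)"
  using assms(1)
proof induction
  case (const c)
  show ?case
    by (rule exI[of _ "\<lambda>_ _. 0"], rule exI[of _ "\<lambda>_ _. c"]) (auto intro: polyfun3_intros)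
next
  case proj1
  show ?case
    by (rule exI[of _ "\<lambda>_ _. 0"], rule exI[of _ "\<lambda>b _. b"]) (auto intro: polyfun3_intros)
next
  case proj2
  show ?case
    by (rule exI[of _ "\<lambda>_ _. 0"], rule exI[of _ "\<lambda>_ y. y"]) (auto intro: polyfun3_intros)
next
  case proj3
  show ?case
    by (rule exI[of _ "\<lambda>_ _. 1"], rule exI[of _ "\<lambda>_ _. 0"]) (auto intro: polyfun3_intros)
next
  case (add f g)
  then obtain v w v' w' where
    h: "polyfun3 (\<lambda>b y _. v b y)" "polyfun3 (\<lambda>b y _. w b y)"
      "polyfun3 (\<lambda>b y _. v' b y)" "polyfun3 (\<lambda>b y _. w' b y)"
    and e: "\<And>b y r. r\<^sup>2 = s b * r + t b \<Longrightarrow> f b y r = v b y * r + w b y"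
      "\<And>b y r. r\<^sup>2 = s b * r + t b \<Longrightarrow> g b y r = v' b y * r + w' b y"
    by blast
  show ?case
    by (rule exI[of _ "\<lambda>b y. v b y + v' b y"], rule exI[of _ "\<lambda>b y. w b y + w' b y"])
      (auto intro!: polyfun3_intros h simp: e algebra_simps)
next
  case (mult f g)
  then obtain v w v' w' where
    h: "polyfun3 (\<lambda>b y _. v b y)" "polyfun3 (\<lambda>b y _. w b y)"
      "polyfun3 (\<lambda>b y _. v' b y)" "polyfun3 (\<lambda>b y _. w' b y)"
    and e: "\<And>b y r. r\<^sup>2 = s b * r + t b \<Longrightarrow> f b y r = v b y * r + w b y"
      "\<And>b y r. r\<^sup>2 = s b * r + t b \<Longrightarrow> g b y r = v' b y * r + w' b y"
    by blast
  have "f b y r * g b y r = (v b y * v' b y * s b + v b y * w' b y + w b y * v' b y) * r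
      + (v b y * v' b y * t b + w b y * w' b y)" if r: "r\<^sup>2 = s b * r + t b" for b y r
    unfolding e[OF r] using r by algebra
  then show ?case
    by (intro exI[of _ "\<lambda>b y. v b y * v' b y * s b + v b y * w' b y + w b y * v' b y"]
        exI[of _ "\<lambda>b y. v b y * v' b y * t b + w b y * w' b y"])
      (auto intro!: polyfun3_intros h assms)
qed

lemma polyfun3_reduce_cubic:
  assumes "polyfun3 Q" and "polyfun3 (\<lambda>b _ _. s b)" and "polyfun3 (\<lambda>b _ _. t b)"
  shows "\<exists>u v w. polyfun3 (\<lambda>b y _. u b y) \<and> polyfun3 (\<lambda>b y _. v b y) \<and> polyfun3 (\<lambda>b y _. w b y) \<and>
    (\<forall>b y r. r ^ 3 = s b * r + t b \<longrightarrow> Q b y r = u b y * r\<^sup>2 + v b y * r + w b y)"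
  using assms(1)
proof induction
  case (const c)
  show ?case
    by (rule exI[of _ "\<lambda>_ _. 0"], rule exI[of _ "\<lambda>_ _. 0"], rule exI[of _ "\<lambda>_ _. c"])
      (auto intro: polyfun3_intros)
next
  case proj1
  show ?case
    by (rule exI[of _ "\<lambda>_ _. 0"], rule exI[of _ "\<lambda>_ _. 0"], rule exI[of _ "\<lambda>b _. b"])
      (auto intro: polyfun3_intros)
next
  case proj2
  show ?case
    by (rule exI[of _ "\<lambda>_ _. 0"], rule exI[of _ "\<lambda>_ _. 0"], rule exI[of _ "\<lambda>_ y. y"])
      (auto intro: polyfun3_intros)
next
  case proj3
  show ?case
    by (rule exI[of _ "\<lambda>_ _. 0"], rule exI[of _ "\<lambda>_ _. 1"], rule exI[of _ "\<lambda>_ _. 0"])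
      (auto intro: polyfun3_intros)
next
  case (add f g)
  from add.IH(1) obtain u v w where
    h: "polyfun3 (\<lambda>b y _. u b y)" "polyfun3 (\<lambda>b y _. v b y)" "polyfun3 (\<lambda>b y _. w b y)"
    and e: "\<And>b y r. r ^ 3 = s b * r + t b \<Longrightarrow> f b y r = u b y * r\<^sup>2 + v b y * r + w b y"
    by (elim exE conjE) (rule that; simp)
  from add.IH(2) obtain u' v' w' where
    h': "polyfun3 (\<lambda>b y _. u' b y)" "polyfun3 (\<lambda>b y _. v' b y)" "polyfun3 (\<lambda>b y _. w' b y)"
    and e': "\<And>b y r. r ^ 3 = s b * r + t b \<Longrightarrow> g b y r = u' b y * r\<^sup>2 + v' b y * r + w' b y"
    by (elim exE conjE) (rule that; simp)
  let ?U = "\<lambda>b y. u b y + u' b y" and ?V = "\<lambda>b y. v b y + v' b y"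
    and ?W = "\<lambda>b y. w b y + w' b y"
  have "polyfun3 (\<lambda>b y _. ?U b y)" "polyfun3 (\<lambda>b y _. ?V b y)" "polyfun3 (\<lambda>b y _. ?W b y)"
    by (intro polyfun3_intros h h')+
  moreover have "f b y r + g b y r = ?U b y * r\<^sup>2 + ?V b y * r + ?W b y"
    if r: "r ^ 3 = s b * r + t b" for b y r
    unfolding e[OF r] e'[OF r] by algebra
  ultimately show ?case by (intro exI[of _ ?U] exI[of _ ?V] exI[of _ ?W] conjI allI impI)
next
  case (mult f g)
  from mult.IH(1) obtain u v w where
    h: "polyfun3 (\<lambda>b y _. u b y)" "polyfun3 (\<lambda>b y _. v b y)" "polyfun3 (\<lambda>b y _. w b y)"
    and e: "\<And>b y r. r ^ 3 = s b * r + t b \<Longrightarrow> f b y r = u b y * r\<^sup>2 + v b y * r + w b y"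
    by (elim exE conjE) (rule that; simp)
  from mult.IH(2) obtain u' v' w' where
    h': "polyfun3 (\<lambda>b y _. u' b y)" "polyfun3 (\<lambda>b y _. v' b y)" "polyfun3 (\<lambda>b y _. w' b y)"
    and e': "\<And>b y r. r ^ 3 = s b * r + t b \<Longrightarrow> g b y r = u' b y * r\<^sup>2 + v' b y * r + w' b y"
    by (elim exE conjE) (rule that; simp)
  let ?U = "\<lambda>b y. u b y * u' b y * s b + u b y * w' b y + v b y * v' b y + w b y * u' b y"
  let ?V = "\<lambda>b y. u b y * u' b y * t b + (u b y * v' b y + v b y * u' b y) * s b
    + v b y * w' b y + w b y * v' b y"
  let ?W = "\<lambda>b y. (u b y * v' b y + v b y * u' b y) * t b + w b y * w' b y"
  have "polyfun3 (\<lambda>b y _. ?U b y)" "polyfun3 (\<lambda>b y _. ?V b y)" "polyfun3 (\<lambda>b y _. ?W b y)"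
    by (intro polyfun3_intros h h' assms)+
  moreover have "f b y r * g b y r = ?U b y * r\<^sup>2 + ?V b y * r + ?W b y"
    if r: "r ^ 3 = s b * r + t b" for b y r
  proof -
    \<comment> \<open>The fourth power is kept as \<open>r * r ^ 3\<close>, so that one rewriting
      with the root equation lowers both the quartic and the cubic term.\<close>
    have "f b y r * g b y r = u b y * u' b y * r * r ^ 3 + (u b y * v' b y + v b y * u' b y) * r ^ 3
      + (u b y * w' b y + v b y * v' b y + w b y * u' b y) * r\<^sup>2
      + (v b y * w' b y + w b y * v' b y) * r + w b y * w' b y"
      unfolding e[OF r] e'[OF r] by (simp add: algebra_simps power2_eq_square power3_eq_cube)
    also have "\<dots> = ?U b y * r\<^sup>2 + ?V b y * r + ?W b y"
      unfolding r by (simp add: algebra_simps power2_eq_square)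
    finally show ?thesis .
  qed
  ultimately show ?case by (intro exI[of _ ?U] exI[of _ ?V] exI[of _ ?W] conjI allI impI)
qed

section \<open>Norms: products over conjugate roots\<close>

text \<open>This is the norm of \<open>Q\<close> evaluated at an algebraic function of
  \<open>b\<close>, with \<open>y\<close> as a free parameter. The value of \<open>N\<close> does
  not depend on \<open>x\<close> for \<open>b > 0\<close>; that slot is kept so that a norm is again
  a \<open>polyfun3\<close> and norms can be nested.\<close>

definition polynomial_norms :: "int set \<Rightarrow> (int \<Rightarrow> real \<Rightarrow> real) \<Rightarrow> bool" where
  "polynomial_norms I r \<longleftrightarrow>
    (\<forall>Q. polyfun3 Q \<longrightarrow>
      (\<exists>N. polyfun3 N \<and> (\<forall>b>0. \<forall>y x. N b y x = (\<Prod>i\<in>I. Q b y (r i b)))))"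

lemma polynomial_norms_linear:
  assumes "\<And>b. r i b = c"
  shows "polynomial_norms {i} r"
  unfolding polynomial_norms_def
proof (intro allI impI)
  fix Q assume "polyfun3 Q"
  then have "polyfun3 (\<lambda>b y _. Q b y c)"
    by (rule polyfun3_subst) (intro polyfun3_intros)+
  then show "\<exists>N. polyfun3 N \<and> (\<forall>b>0. \<forall>y x. N b y x = (\<Prod>i\<in>{i}. Q b y (r i b)))"
    by (intro exI[of _ "\<lambda>b y _. Q b y c"]) (simp add: assms)
qed

text \<open>Once \<open>Q\<close> is reduced to \<open>v r + w\<close>, the product over both roots
  is symmetric in them, and Vieta's relations turn it into
  \<open>w\<^sup>2 + v w s - v\<^sup>2 t\<close>.\<close>

lemma polynomial_norms_quadratic:
  assumes "polyfun3 (\<lambda>b _ _. s b)" and "polyfun3 (\<lambda>b _ _. t b)" and ij: "i \<noteq> j"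
    and s: "\<And>b. b > 0 \<Longrightarrow> r i b + r j b = s b" and t: "\<And>b. b > 0 \<Longrightarrow> r i b * r j b = - t b"
  shows "polynomial_norms {i, j} r"
  unfolding polynomial_norms_def
proof (intro allI impI)
  fix Q assume "polyfun3 Q"
  from polyfun3_reduce_quadratic[OF this assms(1,2)] obtain v w where
    h: "polyfun3 (\<lambda>b y _. v b y)" "polyfun3 (\<lambda>b y _. w b y)"
    and e: "\<And>b y r. r\<^sup>2 = s b * r + t b \<Longrightarrow> Q b y r = v b y * r + w b y"
    by blast
  let ?N = "\<lambda>b y (x::real). (w b y)\<^sup>2 + v b y * w b y * s b - (v b y)\<^sup>2 * t b"
  have N: "polyfun3 ?N" by (intro polyfun3_intros h assms)
  have "?N b y x = (\<Prod>i\<in>{i, j}. Q b y (r i b))" if b: "b > 0" for b y and x :: real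
  proof -
    have st: "s b = r i b + r j b" "t b = - (r i b * r j b)" using s t b by auto
    have "(r i b)\<^sup>2 = s b * r i b + t b" "(r j b)\<^sup>2 = s b * r j b + t b"
      unfolding st by algebra+
    note Q = this[THEN e]
    have "(\<Prod>i\<in>{i, j}. Q b y (r i b)) = Q b y (r i b) * Q b y (r j b)"
      using ij by simp
    also have "\<dots> = ?N b y x"
      unfolding Q st by algebra
    finally show ?thesis by simp
  qed
  with N show "\<exists>N. polyfun3 N \<and> (\<forall>b>0. \<forall>y x. N b y x = (\<Prod>i\<in>{i, j}. Q b y (r i b)))"
    by (intro exI[of _ ?N]) blast
qed

text \<open>The right-hand side is the resultant of \<open>X\<^sup>3 - s X - t\<close> and
  \<open>u X\<^sup>2 + v X + w\<close>. After \<open>c\<close>, \<open>s\<close> and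
  \<open>t\<close> are expressed through \<open>a\<close> and \<open>b\<close>, it is a polynomial
  identity.\<close>

lemma cubic_norm:
  fixes a b c :: real
  assumes z: "a + b + c = 0" and s: "a * b + a * c + b * c = - s" and t: "a * b * c = t"
  shows "(u * a\<^sup>2 + v * a + w) * (u * b\<^sup>2 + v * b + w) * (u * c\<^sup>2 + v * c + w)
    = w ^ 3 + 2 * s * u * w\<^sup>2 - s * v\<^sup>2 * w + s\<^sup>2 * u\<^sup>2 * w - 3 * t * u * v * w
      + t * v ^ 3 - s * t * u\<^sup>2 * v + t\<^sup>2 * u ^ 3"
proof -
  have c: "c = - a - b" using z by simp
  have st: "s = a\<^sup>2 + a * b + b\<^sup>2" "t = - (a * b * (a + b))"
    using s t unfolding c by (simp_all add: algebra_simps power2_eq_square)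
  show ?thesis
    unfolding c st by (simp add: algebra_simps power2_eq_square power3_eq_cube)
qed

lemma cubic_root:
  fixes a b c :: real
  assumes "a + b + c = 0" and "a * b + a * c + b * c = - s" and "a * b * c = t"
  shows "a ^ 3 = s * a + t" and "b ^ 3 = s * b + t" and "c ^ 3 = s * c + t"
  using assms by algebra+

text \<open>The Vieta relations serve twice: they yield the root equation that reduces
  \<open>Q\<close> to a quadratic in the root, and they evaluate the product of the three reduced
  values.\<close>

lemma polynomial_norms_cubic:
  assumes "polyfun3 (\<lambda>b _ _. s b)" and "polyfun3 (\<lambda>b _ _. t b)"
    and ijk: "i \<noteq> j" "i \<noteq> k" "j \<noteq> k"
    and z: "\<And>b. b > 0 \<Longrightarrow> r i b + r j b + r k b = 0"
    and s: "\<And>b. b > 0 \<Longrightarrow> r i b * r j b + r i b * r k b + r j b * r k b = - s b"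
    and t: "\<And>b. b > 0 \<Longrightarrow> r i b * r j b * r k b = t b"
  shows "polynomial_norms {i, j, k} r"
  unfolding polynomial_norms_def
proof (intro allI impI)
  fix Q assume "polyfun3 Q"
  from polyfun3_reduce_cubic[OF this assms(1,2)] obtain u v w where
    h: "polyfun3 (\<lambda>b y _. u b y)" "polyfun3 (\<lambda>b y _. v b y)" "polyfun3 (\<lambda>b y _. w b y)"
    and e: "\<And>b y r. r ^ 3 = s b * r + t b \<Longrightarrow> Q b y r = u b y * r\<^sup>2 + v b y * r + w b y"
    by (elim exE conjE) (rule that; simp)
  let ?N = "\<lambda>b y (x::real). w b y ^ 3 + 2 * s b * u b y * (w b y)\<^sup>2 - s b * (v b y)\<^sup>2 * w b y
    + (s b)\<^sup>2 * (u b y)\<^sup>2 * w b y - 3 * t b * u b y * v b y * w b y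
    + t b * v b y ^ 3 - s b * t b * (u b y)\<^sup>2 * v b y + (t b)\<^sup>2 * u b y ^ 3"
  have N: "polyfun3 ?N" by (intro polyfun3_intros h assms)
  have prod: "?N b y x = (\<Prod>i\<in>{i, j, k}. Q b y (r i b))" if b: "b > 0" for b y and x :: real
  proof -
    note roots = z[OF b] s[OF b] t[OF b]
    have "(\<Prod>i\<in>{i, j, k}. Q b y (r i b)) = Q b y (r i b) * Q b y (r j b) * Q b y (r k b)"
      using ijk by simp
    then show ?thesis
      unfolding cubic_root[OF roots, THEN e] cubic_norm[OF roots] by simp
  qed
  show "\<exists>N. polyfun3 N \<and> (\<forall>b>0. \<forall>y x. N b y x = (\<Prod>i\<in>{i, j, k}. Q b y (r i b)))"
    by (intro exI[of _ ?N] conjI allI impI N prod)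
qed

lemma polynomial_normsE:
  assumes "polynomial_norms I r" and "polyfun3 Q"
  obtains N where "polyfun3 N" and "\<And>b y x. b > 0 \<Longrightarrow> N b y x = (\<Prod>i\<in>I. Q b y (r i b))"
proof -
  have "\<exists>N. polyfun3 N \<and> (\<forall>b>0. \<forall>y x. N b y x = (\<Prod>i\<in>I. Q b y (r i b)))"
    using assms unfolding polynomial_norms_def by simp
  then obtain N where N: "polyfun3 N \<and> (\<forall>b>0. \<forall>y x. N b y x = (\<Prod>i\<in>I. Q b y (r i b)))" ..
  show thesis
    by (rule that[of N]) (simp_all add: N)
qed

text \<open>The three roots are eliminated one after the other, innermost product first; each norm
  becomes the polynomial whose norm is taken next.\<close>

lemma polynomial_norms_sum:
  assumes "polynomial_norms I r" and "polynomial_norms J s" and "polynomial_norms K t"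
  shows "\<exists>p. \<forall>b>0. poly p b = (\<Prod>i\<in>I. \<Prod>j\<in>J. \<Prod>k\<in>K. r i b + s j b - t k b)"
proof -
  have "polyfun3 (\<lambda>b y x. y - x)" by (intro polyfun3_intros)
  from polynomial_normsE[OF assms(3) this] obtain N1 where N1: "polyfun3 N1"
    and N1_eq: "\<And>b y x. b > 0 \<Longrightarrow> N1 b y x = (\<Prod>k\<in>K. y - t k b)"
    by blast
  \<comment> \<open>The second root enters through the shift \<open>y + x\<close>; the final
    \<open>0\<close> fills the slot on which \<open>N1\<close> no longer depends.\<close>
  have "polyfun3 (\<lambda>b y x. N1 b (y + x) 0)"
    by (rule polyfun3_subst[OF N1]) (intro polyfun3_intros)+
  from polynomial_normsE[OF assms(2) this] obtain N2 where N2: "polyfun3 N2"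
    and N2_eq: "\<And>b y x. b > 0 \<Longrightarrow> N2 b y x = (\<Prod>j\<in>J. N1 b (y + s j b) 0)"
    by blast
  have "polyfun3 (\<lambda>b y x. N2 b x 0)"
    by (rule polyfun3_subst[OF N2]) (intro polyfun3_intros)+
  from polynomial_normsE[OF assms(1) this] obtain N3 where N3: "polyfun3 N3"
    and N3_eq: "\<And>b y x. b > 0 \<Longrightarrow> N3 b y x = (\<Prod>i\<in>I. N2 b (r i b) 0)"
    by blast
  obtain p where "\<And>b. N3 b 0 0 = poly p b" using polyfun3_imp_poly[OF N3] by metis
  then have "poly p b = (\<Prod>i\<in>I. \<Prod>j\<in>J. \<Prod>k\<in>K. r i b + s j b - t k b)" if "b > 0" for b
    using N3_eq[OF that, of 0 0] by (simp add: N2_eq N1_eq that)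
  then show ?thesis by blast
qed

section \<open>Fast and slow branches for large \<open>\<beta>\<close>\<close>

definition fast_branch :: "nat \<Rightarrow> real \<Rightarrow> real \<Rightarrow> (real \<Rightarrow> real) \<Rightarrow> bool" where
  "fast_branch N \<sigma> k r \<longleftrightarrow>
    odd N \<and> \<sigma>\<^sup>2 = 1 \<and> ((\<lambda>b. r b - \<sigma> * sqrt (b * real N)) \<longlongrightarrow> k / (2 * real N)) at_top"

text \<open>The factor \<open>b\<close> makes the limit record the term of order
  \<open>1 / b\<close>. At \<open>x = -1\<close> its coefficient vanishes, as it must for the Kelvin
  root, which equals \<open>k\<close> exactly. The bound \<open>1 / 3\<close> reflects
  \<open>x = 1 / (2 n + 1)\<close> with \<open>n \<ge> 1\<close>.\<close>

definition slow_branch :: "real \<Rightarrow> real \<Rightarrow> (real \<Rightarrow> real) \<Rightarrow> bool" where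
  "slow_branch x k r \<longleftrightarrow>
    k \<noteq> 0 \<and> (x = -1 \<or> 0 < x \<and> x \<le> 1 / 3) \<and>
    ((\<lambda>b. b * (r b + k * x)) \<longlongrightarrow> k ^ 3 * (x\<^sup>2 - x ^ 4)) at_top"

text \<open>Negating the third branch puts a resonance into the symmetric form
  \<open>r1 + r2 + r3 = 0\<close> with \<open>k1 + k2 + k3 = 0\<close>, where the order of the
  branches is immaterial.\<close>

lemma fast_branch_uminus:
  assumes "fast_branch N \<sigma> k r"
  shows "fast_branch N (- \<sigma>) (- k) (\<lambda>b. - r b)"
proof -
  have "((\<lambda>b. - (r b - \<sigma> * sqrt (b * real N))) \<longlongrightarrow> - (k / (2 * real N))) at_top"
    using assms by (intro tendsto_minus) (simp add: fast_branch_def)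
  then show ?thesis using assms by (simp add: fast_branch_def)
qed

lemma slow_branch_uminus:
  assumes "slow_branch x k r"
  shows "slow_branch x (- k) (\<lambda>b. - r b)"
proof -
  have "((\<lambda>b. - (b * (r b + k * x))) \<longlongrightarrow> - (k ^ 3 * (x\<^sup>2 - x ^ 4))) at_top"
    using assms by (intro tendsto_minus) (simp add: slow_branch_def)
  moreover have "(\<lambda>b. - (b * (r b + k * x))) = (\<lambda>b. b * (- r b + - k * x))"
    by (simp add: algebra_simps)
  ultimately show ?thesis using assms by (simp add: slow_branch_def)
qed

lemma fast_branch_leading:
  assumes "fast_branch N \<sigma> k r"
  shows "((\<lambda>b. r b / sqrt b) \<longlongrightarrow> \<sigma> * sqrt (real N)) at_top"
proof -
  have "((\<lambda>b. r b - \<sigma> * sqrt (b * real N)) \<longlongrightarrow> k / (2 * real N)) at_top"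
    using assms by (simp add: fast_branch_def)
  moreover have "((\<lambda>b::real. 1 / sqrt b) \<longlongrightarrow> 0) at_top" by real_asymp
  ultimately have "((\<lambda>b. (r b - \<sigma> * sqrt (b * real N)) * (1 / sqrt b))
      \<longlongrightarrow> k / (2 * real N) * 0) at_top"
    by (rule tendsto_mult)
  from tendsto_add[OF this tendsto_const[of "\<sigma> * sqrt (real N)"]]
  have "((\<lambda>b. (r b - \<sigma> * sqrt (b * real N)) * (1 / sqrt b) + \<sigma> * sqrt (real N))
      \<longlongrightarrow> \<sigma> * sqrt (real N)) at_top" by simp
  moreover have "\<forall>\<^sub>F b in at_top. (r b - \<sigma> * sqrt (b * real N)) * (1 / sqrt b) + \<sigma> * sqrt (real N)
      = r b / sqrt b"
    using eventually_gt_at_top[of 0]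
    by eventually_elim (simp add: field_simps real_sqrt_mult)
  ultimately show ?thesis by (rule Lim_transform_eventually)
qed

lemma slow_branch_limit:
  assumes "slow_branch x k r"
  shows "(r \<longlongrightarrow> - (k * x)) at_top"
proof -
  have "((\<lambda>b. b * (r b + k * x)) \<longlongrightarrow> k ^ 3 * (x\<^sup>2 - x ^ 4)) at_top"
    using assms by (simp add: slow_branch_def)
  moreover have "((\<lambda>b::real. 1 / b) \<longlongrightarrow> 0) at_top" by real_asymp
  ultimately have "((\<lambda>b. b * (r b + k * x) * (1 / b)) \<longlongrightarrow> k ^ 3 * (x\<^sup>2 - x ^ 4) * 0) at_top"
    by (rule tendsto_mult)
  from tendsto_diff[OF this tendsto_const[of "k * x"]]
  have "((\<lambda>b. b * (r b + k * x) * (1 / b) - k * x) \<longlongrightarrow> - (k * x)) at_top" by simp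
  moreover have "\<forall>\<^sub>F b in at_top. b * (r b + k * x) * (1 / b) - k * x = r b"
    using eventually_gt_at_top[of 0] by eventually_elim simp
  ultimately show ?thesis by (rule Lim_transform_eventually)
qed

lemma slow_branch_leading:
  assumes "slow_branch x k r"
  shows "((\<lambda>b. r b / sqrt b) \<longlongrightarrow> 0) at_top"
proof -
  have "((\<lambda>b::real. 1 / sqrt b) \<longlongrightarrow> 0) at_top" by real_asymp
  from tendsto_mult[OF slow_branch_limit[OF assms] this] show ?thesis by simp
qed

section \<open>Three branches cannot cancel for arbitrarily large \<open>\<beta>\<close>\<close>

text \<open>A nonzero limit would keep \<open>f\<close> away from zero eventually. This extracts one
  algebraic condition from each order of the expansion.\<close>

lemma frequently_zero_limit:
  fixes f :: "real \<Rightarrow> real"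
  assumes "(f \<longlongrightarrow> L) at_top" and "\<exists>\<^sub>F b in at_top. f b = 0"
  shows "L = 0"
proof (rule ccontr)
  assume "L \<noteq> 0"
  then have "\<forall>\<^sub>F b in at_top. f b \<noteq> 0" using assms(1) by (rule tendsto_imp_eventually_ne[rotated])
  with assms(2) show False by (simp add: frequently_def)
qed

lemma leading_terms_cancel:
  fixes r1 r2 r3 :: "real \<Rightarrow> real"
  assumes "((\<lambda>b. r1 b / sqrt b) \<longlongrightarrow> c1) at_top" and "((\<lambda>b. r2 b / sqrt b) \<longlongrightarrow> c2) at_top"
    and "((\<lambda>b. r3 b / sqrt b) \<longlongrightarrow> c3) at_top"
    and "\<exists>\<^sub>F b in at_top. r1 b + r2 b + r3 b = 0"
  shows "c1 + c2 + c3 = 0"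
proof (rule frequently_zero_limit)
  show "((\<lambda>b. r1 b / sqrt b + r2 b / sqrt b + r3 b / sqrt b) \<longlongrightarrow> c1 + c2 + c3) at_top"
    by (intro tendsto_intros assms)
  show "\<exists>\<^sub>F b in at_top. r1 b / sqrt b + r2 b / sqrt b + r3 b / sqrt b = 0"
    using assms(4) by (rule frequently_elim1) (simp flip: add_divide_distrib)
qed

text \<open>Isolating one root and squaring twice gives \<open>(N - L - M)\<^sup>2 = 4 L M\<close>,
  an odd number equal to an even one.\<close>

lemma signed_sqrt_odd_sum_nonzero:
  fixes L M N :: nat and \<rho> \<sigma> \<tau> :: real
  assumes odd: "odd L" "odd M" "odd N"
    and sgn: "\<rho>\<^sup>2 = 1" "\<sigma>\<^sup>2 = 1" "\<tau>\<^sup>2 = 1"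
  shows "\<rho> * sqrt L + \<sigma> * sqrt M + \<tau> * sqrt N \<noteq> 0"
proof
  define l m n where "l = sqrt (real L)" and "m = sqrt (real M)" and "n = sqrt (real N)"
  assume "\<rho> * sqrt L + \<sigma> * sqrt M + \<tau> * sqrt N = 0"
  then have e: "\<tau> * n = - (\<rho> * l + \<sigma> * m)" by (simp add: l_def m_def n_def)
  have sq: "l\<^sup>2 = L" "m\<^sup>2 = M" "n\<^sup>2 = N" by (simp_all add: l_def m_def n_def)
  have "(\<tau> * n)\<^sup>2 = (\<rho> * l + \<sigma> * m)\<^sup>2" unfolding e by (rule power2_minus)
  then have "n\<^sup>2 = l\<^sup>2 + m\<^sup>2 + 2 * (\<rho> * \<sigma> * (l * m))"
    using sgn by (simp add: power2_sum power_mult_distrib algebra_simps)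
  then have d: "real N - real L - real M = 2 * (\<rho> * \<sigma> * (l * m))" using sq by simp
  have "(real N - real L - real M)\<^sup>2 = 4 * real L * real M"
    unfolding d using sgn sq by (simp add: power_mult_distrib)
  then have "real_of_int ((int N - int L - int M)\<^sup>2) = real_of_int (4 * int L * int M)" by simp
  then have "(int N - int L - int M)\<^sup>2 = 4 * int L * int M" by (simp only: of_int_eq_iff)
  moreover have "odd ((int N - int L - int M)\<^sup>2)" using odd by simp
  ultimately show False by simp
qed

lemma no_resonance_fast_fast_fast:
  assumes "fast_branch N1 \<sigma>1 k1 r1" and "fast_branch N2 \<sigma>2 k2 r2" and "fast_branch N3 \<sigma>3 k3 r3"
  shows "\<not> (\<exists>\<^sub>F b in at_top. r1 b + r2 b + r3 b = 0)"
  using leading_terms_cancel[OF assms[THEN fast_branch_leading]]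
    signed_sqrt_odd_sum_nonzero[of N1 N2 N3 \<sigma>1 \<sigma>2 \<sigma>3] assms
  by (auto simp: fast_branch_def)

lemma no_resonance_fast_slow_slow:
  assumes "fast_branch N \<sigma> k1 r1" and "slow_branch x k2 r2" and "slow_branch y k3 r3"
  shows "\<not> (\<exists>\<^sub>F b in at_top. r1 b + r2 b + r3 b = 0)"
proof
  assume "\<exists>\<^sub>F b in at_top. r1 b + r2 b + r3 b = 0"
  from leading_terms_cancel[OF fast_branch_leading[OF assms(1)] slow_branch_leading[OF assms(2)]
      slow_branch_leading[OF assms(3)] this]
  have "\<sigma> = 0 \<or> N = 0" by simp
  then show False using assms(1) by (auto simp: fast_branch_def)
qed

text \<open>Order \<open>sqrt b\<close> forces \<open>M = N\<close> and opposite signs. The constant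
  order then gives \<open>(k1 + k2) / (2 N) = k3 x\<close>, that is \<open>2 x N = -1\<close>, which
  neither a positive \<open>x\<close> nor \<open>x = -1\<close> allows.\<close>

lemma no_resonance_fast_fast_slow:
  assumes f1: "fast_branch M \<rho> k1 r1" and f2: "fast_branch N \<sigma> k2 r2" and s: "slow_branch x k3 r3"
    and k: "k1 + k2 + k3 = 0"
  shows "\<not> (\<exists>\<^sub>F b in at_top. r1 b + r2 b + r3 b = 0)"
proof
  assume fr: "\<exists>\<^sub>F b in at_top. r1 b + r2 b + r3 b = 0"
  have N0: "N > 0" using f2 by (auto simp: fast_branch_def intro: Nat.gr0I)
  from leading_terms_cancel[OF fast_branch_leading[OF f1] fast_branch_leading[OF f2]
      slow_branch_leading[OF s] fr]
  have e: "\<rho> * sqrt M = - (\<sigma> * sqrt N)" by simp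
  have "\<rho>\<^sup>2 = 1" "\<sigma>\<^sup>2 = 1" using f1 f2 by (auto simp: fast_branch_def)
  then have "real M = (\<rho> * sqrt M)\<^sup>2" "(\<sigma> * sqrt N)\<^sup>2 = real N"
    by (simp_all add: power_mult_distrib)
  then have "M = N" unfolding e by simp
  with e N0 have \<rho>: "\<rho> = - \<sigma>"
    by (metis mult_minus_left mult_right_cancel of_nat_0_less_iff real_sqrt_gt_0_iff less_irrefl)
  have "((\<lambda>b. (r1 b - \<rho> * sqrt (b * real M)) + (r2 b - \<sigma> * sqrt (b * real N)) + r3 b)
      \<longlongrightarrow> k1 / (2 * real M) + k2 / (2 * real N) + - (k3 * x)) at_top"
    using f1 f2 by (intro tendsto_add slow_branch_limit[OF s]) (auto simp: fast_branch_def)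
  \<comment> \<open>With equal \<open>N\<close> and opposite signs the two square roots cancel
    identically.\<close>
  then have "((\<lambda>b. r1 b + r2 b + r3 b) \<longlongrightarrow> k1 / (2 * real N) + k2 / (2 * real N) + - (k3 * x)) at_top"
    by (simp add: \<open>M = N\<close> \<rho>)
  from frequently_zero_limit[OF this fr]
  have "(k1 + k2) / (2 * real N) = k3 * x" by (simp add: add_divide_distrib)
  moreover have "k1 + k2 = - k3" using k by simp
  ultimately have "- k3 = k3 * (x * (2 * real N))" using N0 by (simp add: field_simps)
  then have "k3 * (1 + 2 * (x * real N)) = 0" by (simp add: algebra_simps)
  then have "2 * (x * real N) = -1" using s by (auto simp: slow_branch_def)
  moreover have "x = -1 \<or> x > 0" using s by (auto simp: slow_branch_def)
  ultimately show False
  proof (elim disjE)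
    assume "2 * (x * real N) = -1" "x = -1"
    then have "2 * real N = 1" by simp
    then show False using N0 by linarith
  next
    assume "2 * (x * real N) = -1" "x > 0"
    moreover have "x * real N > 0" using \<open>x > 0\<close> N0 by simp
    ultimately show False by linarith
  qed
qed

text \<open>The two linear relations give \<open>(k\<^sub>1, k\<^sub>2, k\<^sub>3) = c (x\<^sub>2 - x\<^sub>3, x\<^sub>3 - x\<^sub>1, x\<^sub>1 - x\<^sub>2)\<close>. The left-hand side is
  then antisymmetric in the \<open>x\<^sub>i\<close>, and \<open>k\<^sub>1 k\<^sub>2 k\<^sub>3\<close> absorbs its Vandermonde factor.\<close>

lemma slow_second_order:
  fixes k1 k2 k3 x1 x2 x3 :: real
  assumes k: "k1 + k2 + k3 = 0" and kx: "k1 * x1 + k2 * x2 + k3 * x3 = 0" and ne: "x1 \<noteq> x3"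
  shows "k1 ^ 3 * (x1\<^sup>2 - x1 ^ 4) + k2 ^ 3 * (x2\<^sup>2 - x2 ^ 4) + k3 ^ 3 * (x3\<^sup>2 - x3 ^ 4)
    = k1 * k2 * k3 * ((x1 * x2 + x1 * x3 + x2 * x3) + (x1 * x2 + x1 * x3 + x2 * x3)\<^sup>2
        - 4 * (x1 + x2 + x3) * (x1 * x2 * x3))"
proof -
  define c where "c = k2 / (x3 - x1)"
  have k2: "k2 = c * (x3 - x1)" using ne by (simp add: c_def)
  have k3: "k3 = - k1 - k2" using k by simp
  have "(k1 - c * (x2 - x3)) * (x1 - x3) = 0" using kx unfolding k3 k2 by algebra
  then have k1: "k1 = c * (x2 - x3)" using ne by simp
  have k3: "k3 = c * (x1 - x2)" unfolding k3 k1 k2 by algebra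
  show ?thesis unfolding k1 k2 k3 by algebra
qed

text \<open>A sum of squares gives \<open>3 (a + b + c) a b c \<le> e\<^sup>2\<close> for the second
  elementary symmetric function \<open>e\<close>. The expression is thus at least
  \<open>e - e\<^sup>2 / 3\<close>, and \<open>0 < e \<le> 1 / 3\<close>.\<close>

lemma slow_second_order_pos:
  fixes a b c :: real
  assumes "0 < a" "0 < b" "0 < c" "a \<le> 1 / 3" "b \<le> 1 / 3" "c \<le> 1 / 3"
  shows "(a * b + a * c + b * c) + (a * b + a * c + b * c)\<^sup>2 - 4 * (a + b + c) * (a * b * c) > 0"
proof -
  define e where "e = a * b + a * c + b * c"
  have "a * b \<le> 1 / 3 * (1 / 3)" "a * c \<le> 1 / 3 * (1 / 3)" "b * c \<le> 1 / 3 * (1 / 3)"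
    using assms by (intro mult_mono; simp)+
  then have e1: "e \<le> 1 / 3" by (simp add: e_def)
  have e0: "e > 0" using assms by (simp add: e_def add_pos_pos)
  have "e\<^sup>2 - 3 * ((a + b + c) * (a * b * c))
      = ((a * b - a * c)\<^sup>2 + (a * b - b * c)\<^sup>2 + (a * c - b * c)\<^sup>2) / 2"
    unfolding e_def by (simp add: power2_eq_square algebra_simps)
  also have "\<dots> \<ge> 0" by simp
  finally have "3 * ((a + b + c) * (a * b * c)) \<le> e\<^sup>2" by simp
  moreover have "e * e \<le> e * (1 / 3)" using e0 e1 by (intro mult_left_mono) auto
  ultimately have "e + e\<^sup>2 - 4 * ((a + b + c) * (a * b * c)) > 0"
    using e0 unfolding power2_eq_square by linarith
  then show ?thesis by (simp only: e_def mult.assoc)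
qed

text \<open>With \<open>s = a + b\<close> and \<open>p = a b\<close> the expression is
  \<open>(p + s)\<^sup>2 - 3 p - s\<close>. Since \<open>p + s \<le> 1 / 9 + 2 / 3 < 1\<close>, it
  is at most \<open>- 2 p\<close>.\<close>

lemma slow_second_order_kelvin:
  fixes a b c :: real
  assumes "0 < a" "0 < b" "a \<le> 1 / 3" "b \<le> 1 / 3" and c: "c = -1"
  shows "(a * b + a * c + b * c) + (a * b + a * c + b * c)\<^sup>2 - 4 * (a + b + c) * (a * b * c) < 0"
proof -
  define s p where "s = a + b" and "p = a * b"
  have p0: "p > 0" using assms by (simp add: p_def)
  have s0: "s > 0" "s \<le> 2 / 3" using assms by (simp_all add: s_def)
  have "p \<le> 1 / 3 * (1 / 3)" unfolding p_def using assms by (intro mult_mono) auto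
  then have "(p + s) * (p + s) \<le> (p + s) * 1" using p0 s0 by (intro mult_left_mono) auto
  moreover have "(a * b + a * c + b * c) + (a * b + a * c + b * c)\<^sup>2 - 4 * (a + b + c) * (a * b * c)
      = (p + s) * (p + s) - 3 * p - s"
    unfolding c s_def p_def by (simp add: power2_eq_square algebra_simps)
  ultimately show ?thesis using p0 by simp
qed

text \<open>If two slopes agree, all three do, and the second-order condition leaves only
  \<open>-1\<close>. If they are pairwise distinct, at most one is \<open>-1\<close>, and the
  symmetric factor from \<open>slow_second_order\<close> is positive or negative accordingly, never
  zero.\<close>

lemma slow_coefficients:
  fixes k1 k2 k3 x1 x2 x3 :: real
  assumes nz: "k1 \<noteq> 0" "k2 \<noteq> 0" "k3 \<noteq> 0"
    and x: "x1 = -1 \<or> 0 < x1 \<and> x1 \<le> 1 / 3" "x2 = -1 \<or> 0 < x2 \<and> x2 \<le> 1 / 3"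
      "x3 = -1 \<or> 0 < x3 \<and> x3 \<le> 1 / 3"
    and k: "k1 + k2 + k3 = 0" and kx: "k1 * x1 + k2 * x2 + k3 * x3 = 0"
    and kxx: "k1 ^ 3 * (x1\<^sup>2 - x1 ^ 4) + k2 ^ 3 * (x2\<^sup>2 - x2 ^ 4) + k3 ^ 3 * (x3\<^sup>2 - x3 ^ 4) = 0"
  shows "x1 = -1 \<and> x2 = -1 \<and> x3 = -1"
proof -
  have k3: "k3 = - k1 - k2" using k by simp
  have "k1 * (x1 - x3) + k2 * (x2 - x3) = 0" using kx unfolding k3 by algebra
  then have eq13: "x1 = x3 \<longleftrightarrow> x2 = x3" using nz by auto
  have "k1 * (x1 - x2) + k3 * (x3 - x2) = 0" using kx k by algebra
  then have eq12: "x1 = x2 \<longleftrightarrow> x2 = x3" using nz by auto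
  show ?thesis
  proof (cases "x1 = x3")
    case True
    then have eq: "x2 = x1" "x3 = x1" using eq13 by auto
    \<comment> \<open>A sum of three cubes is three times their product of bases when the bases add
      up to zero.\<close>
    have "3 * (k1 * k2 * k3) * (x1\<^sup>2 - x1 ^ 4) = 0"
      using kxx unfolding eq k3 by algebra
    then have "x1\<^sup>2 * ((1 - x1) * (1 + x1)) = 0" using nz by (simp add: algebra_simps power2_eq_square eval_nat_numeral)
    then show ?thesis using x(1) eq by auto
  next
    case False
    have "(x1 * x2 + x1 * x3 + x2 * x3) + (x1 * x2 + x1 * x3 + x2 * x3)\<^sup>2
        - 4 * (x1 + x2 + x3) * (x1 * x2 * x3) = 0" (is "?E x1 x2 x3 = 0")
      using slow_second_order[OF k kx False] kxx nz by simp
    \<comment> \<open>Symmetry of the expression moves a slope \<open>-1\<close> from any position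
      into the last one.\<close>
    moreover have "?E x1 x2 x3 = ?E x1 x3 x2" "?E x1 x2 x3 = ?E x2 x3 x1"
      by (simp_all add: algebra_simps)
    ultimately have "?E x1 x2 x3 = 0" "?E x1 x3 x2 = 0" "?E x2 x3 x1 = 0" by simp_all
    then show ?thesis
      using x False eq13 eq12 slow_second_order_pos[of x1 x2 x3] slow_second_order_kelvin[of x1 x2 x3]
        slow_second_order_kelvin[of x1 x3 x2] slow_second_order_kelvin[of x2 x3 x1]
      by argo
  qed
qed

lemma no_resonance_slow_slow_slow:
  assumes s: "slow_branch x1 k1 r1" "slow_branch x2 k2 r2" "slow_branch x3 k3 r3"
    and k: "k1 + k2 + k3 = 0" and x: "\<not> (x1 = -1 \<and> x2 = -1 \<and> x3 = -1)"
  shows "\<not> (\<exists>\<^sub>F b in at_top. r1 b + r2 b + r3 b = 0)"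
proof
  assume fr: "\<exists>\<^sub>F b in at_top. r1 b + r2 b + r3 b = 0"
  have "((\<lambda>b. r1 b + r2 b + r3 b) \<longlongrightarrow> - (k1 * x1) + - (k2 * x2) + - (k3 * x3)) at_top"
    by (intro tendsto_add s[THEN slow_branch_limit])
  from frequently_zero_limit[OF this fr] have kx: "k1 * x1 + k2 * x2 + k3 * x3 = 0" by simp
  have "((\<lambda>b. b * (r1 b + k1 * x1) + b * (r2 b + k2 * x2) + b * (r3 b + k3 * x3)) \<longlongrightarrow>
      k1 ^ 3 * (x1\<^sup>2 - x1 ^ 4) + k2 ^ 3 * (x2\<^sup>2 - x2 ^ 4) + k3 ^ 3 * (x3\<^sup>2 - x3 ^ 4)) at_top"
    using s by (intro tendsto_add) (auto simp: slow_branch_def)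
  \<comment> \<open>The first-order terms add up to zero by \<open>kx\<close>, so the limit concerns
    \<open>b\<close> times the plain sum of the branches.\<close>
  also have "(\<lambda>b. b * (r1 b + k1 * x1) + b * (r2 b + k2 * x2) + b * (r3 b + k3 * x3))
      = (\<lambda>b. b * (r1 b + r2 b + r3 b + (k1 * x1 + k2 * x2 + k3 * x3)))"
    by (simp add: algebra_simps)
  finally have "((\<lambda>b. b * (r1 b + r2 b + r3 b)) \<longlongrightarrow>
      k1 ^ 3 * (x1\<^sup>2 - x1 ^ 4) + k2 ^ 3 * (x2\<^sup>2 - x2 ^ 4) + k3 ^ 3 * (x3\<^sup>2 - x3 ^ 4)) at_top"
    by (simp add: kx)
  moreover have "\<exists>\<^sub>F b in at_top. b * (r1 b + r2 b + r3 b) = 0"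
    using fr by (rule frequently_elim1) simp
  ultimately have kxx: "k1 ^ 3 * (x1\<^sup>2 - x1 ^ 4) + k2 ^ 3 * (x2\<^sup>2 - x2 ^ 4)
      + k3 ^ 3 * (x3\<^sup>2 - x3 ^ 4) = 0"
    by (rule frequently_zero_limit)
  show False
    using slow_coefficients[OF _ _ _ _ _ _ k kx kxx] s x by (auto simp: slow_branch_def)
qed

text \<open>The flag \<open>K\<close> permits the slope \<open>x = -1\<close>, which only Kelvin waves have.\<close>

definition branch :: "bool \<Rightarrow> real \<Rightarrow> (real \<Rightarrow> real) \<Rightarrow> bool" where
  "branch K k r \<longleftrightarrow>
    (\<exists>N \<sigma>. fast_branch N \<sigma> k r) \<or> (\<exists>x. slow_branch x k r \<and> (x = -1 \<longrightarrow> K))"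

lemma branch_uminus: "branch K k r \<Longrightarrow> branch K (- k) (\<lambda>b. - r b)"
  unfolding branch_def
  by (elim disjE exE conjE) (blast intro: fast_branch_uminus slow_branch_uminus)+

lemma no_resonance:
  assumes "branch K1 k1 r1" and "branch K2 k2 r2" and "branch K3 k3 r3"
    and k: "k1 + k2 + k3 = 0" and K: "\<not> (K1 \<and> K2 \<and> K3)"
  shows "\<forall>\<^sub>F b in at_top. r1 b + r2 b + r3 b \<noteq> 0"
proof -
  \<comment> \<open>These rearrangements move the branches into the order expected by the lemmas
    with both fast and slow branches: fast ones first.\<close>
  have perm: "(\<lambda>b. r1 b + r2 b + r3 b = 0) = (\<lambda>b. r1 b + r3 b + r2 b = 0)"
    "(\<lambda>b. r1 b + r2 b + r3 b = 0) = (\<lambda>b. r2 b + r1 b + r3 b = 0)"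
    "(\<lambda>b. r1 b + r2 b + r3 b = 0) = (\<lambda>b. r2 b + r3 b + r1 b = 0)"
    "(\<lambda>b. r1 b + r2 b + r3 b = 0) = (\<lambda>b. r3 b + r1 b + r2 b = 0)"
    by (auto simp: add_ac)
  have k': "k1 + k3 + k2 = 0" "k2 + k3 + k1 = 0" using k by simp_all
  have "\<not> (\<exists>\<^sub>F b in at_top. r1 b + r2 b + r3 b = 0)"
    using assms(1)[unfolded branch_def]
  proof (elim disjE exE conjE)
    fix N1 \<sigma>1 assume 1: "fast_branch N1 \<sigma>1 k1 r1"
    show ?thesis using assms(2)[unfolded branch_def]
    proof (elim disjE exE conjE)
      fix N2 \<sigma>2 assume 2: "fast_branch N2 \<sigma>2 k2 r2"
      show ?thesis using assms(3)[unfolded branch_def]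
        using no_resonance_fast_fast_fast[OF 1 2] no_resonance_fast_fast_slow[OF 1 2 _ k] by blast
    next
      fix x2 assume 2: "slow_branch x2 k2 r2"
      show ?thesis using assms(3)[unfolded branch_def]
      proof (elim disjE exE conjE)
        fix N3 \<sigma>3 assume 3: "fast_branch N3 \<sigma>3 k3 r3"
        show ?thesis unfolding perm(1) by (rule no_resonance_fast_fast_slow[OF 1 3 2 k'(1)])
      next
        fix x3 assume 3: "slow_branch x3 k3 r3"
        show ?thesis by (rule no_resonance_fast_slow_slow[OF 1 2 3])
      qed
    qed
  next
    fix x1 assume 1: "slow_branch x1 k1 r1" "x1 = -1 \<longrightarrow> K1"
    show ?thesis using assms(2)[unfolded branch_def]
    proof (elim disjE exE conjE)
      fix N2 \<sigma>2 assume 2: "fast_branch N2 \<sigma>2 k2 r2"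
      show ?thesis using assms(3)[unfolded branch_def]
      proof (elim disjE exE conjE)
        fix N3 \<sigma>3 assume 3: "fast_branch N3 \<sigma>3 k3 r3"
        show ?thesis unfolding perm(3) by (rule no_resonance_fast_fast_slow[OF 2 3 1(1) k'(2)])
      next
        fix x3 assume 3: "slow_branch x3 k3 r3"
        show ?thesis unfolding perm(2) by (rule no_resonance_fast_slow_slow[OF 2 1(1) 3])
      qed
    next
      fix x2 assume 2: "slow_branch x2 k2 r2" "x2 = -1 \<longrightarrow> K2"
      show ?thesis using assms(3)[unfolded branch_def]
      proof (elim disjE exE conjE)
        fix N3 \<sigma>3 assume 3: "fast_branch N3 \<sigma>3 k3 r3"
        show ?thesis unfolding perm(4) by (rule no_resonance_fast_slow_slow[OF 3 1(1) 2(1)])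
      next
        fix x3 assume 3: "slow_branch x3 k3 r3" "x3 = -1 \<longrightarrow> K3"
        show ?thesis
          by (rule no_resonance_slow_slow_slow[OF 1(1) 2(1) 3(1) k]) (use 1(2) 2(2) 3(2) K in blast)
      qed
    qed
  qed
  then show ?thesis by (simp add: frequently_def)
qed

section \<open>Vieta relations and expansions of the eigenvalues\<close>

lemma tau_root:
  fixes \<beta> :: real and n :: nat and k j :: int
  assumes "\<beta> > 0" and "n \<ge> 1" and "j \<in> {-1, 0, 1}"
  shows "tau \<beta> n k j ^ 3 = ((real_of_int k)\<^sup>2 + \<beta> * (2 * real n + 1)) * tau \<beta> n k j + \<beta> * k"
proof -
  have "tau \<beta> n k j \<in> {x. poly (tau_poly \<beta> n k) x = 0}"
    using tau_roots(3)[OF assms(1,2)] assms(3) by auto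
  then show ?thesis by (simp only: poly_tau_poly mem_Collect_eq)
qed

text \<open>Subtracting root equations and dividing by \<open>a - b\<close> and \<open>a - c\<close>
  leaves two quadratic relations, whose difference is
  \<open>(b - c) (a + b + c) = 0\<close>.\<close>

lemma depressed_cubic_vieta:
  fixes a b c :: real
  assumes ab: "a \<noteq> b" and ac: "a \<noteq> c" and bc: "b \<noteq> c"
    and a: "a ^ 3 = s * a + t" and b: "b ^ 3 = s * b + t" and c: "c ^ 3 = s * c + t"
  shows "a + b + c = 0" and "a * b + a * c + b * c = - s" and "a * b * c = t"
proof -
  have "(a - b) * (a\<^sup>2 + a * b + b\<^sup>2 - s) = 0" using a b by algebra
  then have 1: "a\<^sup>2 + a * b + b\<^sup>2 = s" using ab by simp
  have "(a - c) * (a\<^sup>2 + a * c + c\<^sup>2 - s) = 0" using a c by algebra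
  then have 2: "a\<^sup>2 + a * c + c\<^sup>2 = s" using ac by simp
  have "(b - c) * (a + b + c) = 0" using 1 2 by (simp add: algebra_simps power2_eq_square)
  then show z: "a + b + c = 0" using bc by simp
  show p: "a * b + a * c + b * c = - s"
  proof -
    have c: "c = - a - b" using z by simp
    from 1 show ?thesis unfolding c by (simp add: algebra_simps power2_eq_square)
  qed
  show "a * b * c = t" using a z p by algebra
qed

lemma tau_vieta:
  fixes \<beta> :: real and n :: nat and k :: int
  assumes "\<beta> > 0" and "n \<ge> 1"
  defines "s \<equiv> (real_of_int k)\<^sup>2 + \<beta> * (2 * real n + 1)"
  shows "tau \<beta> n k (-1) + tau \<beta> n k 0 + tau \<beta> n k 1 = 0"
    and "tau \<beta> n k (-1) * tau \<beta> n k 0 + tau \<beta> n k (-1) * tau \<beta> n k 1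
      + tau \<beta> n k 0 * tau \<beta> n k 1 = - s"
    and "tau \<beta> n k (-1) * tau \<beta> n k 0 * tau \<beta> n k 1 = \<beta> * k"
proof -
  have ne: "tau \<beta> n k (-1) \<noteq> tau \<beta> n k 0" "tau \<beta> n k (-1) \<noteq> tau \<beta> n k 1" "tau \<beta> n k 0 \<noteq> tau \<beta> n k 1"
    using tau_roots(1,2)[OF assms(1,2), of k] by linarith+
  note v = depressed_cubic_vieta[OF ne tau_root[OF assms(1,2)] tau_root[OF assms(1,2)]
      tau_root[OF assms(1,2)], simplified]
  show "tau \<beta> n k (-1) + tau \<beta> n k 0 + tau \<beta> n k 1 = 0"
    "tau \<beta> n k (-1) * tau \<beta> n k 0 + tau \<beta> n k (-1) * tau \<beta> n k 1
      + tau \<beta> n k 0 * tau \<beta> n k 1 = - s"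
    "tau \<beta> n k (-1) * tau \<beta> n k 0 * tau \<beta> n k 1 = \<beta> * k"
    using v unfolding s_def by simp_all
qed

text \<open>Since \<open>b\<close> lies between \<open>a\<close> and \<open>c\<close>,
  \<open>s - 3 b\<^sup>2 = (b - a) (c - b)\<close> is positive, so
  \<open>s - b\<^sup>2 \<ge> 2 s / 3\<close>. The root equation reads
  \<open>b (s - b\<^sup>2) = - \<beta> k\<close>, and \<open>\<beta> \<le> s\<close>. The bound is
  uniform in \<open>\<beta>\<close> and forces the root to vanish when \<open>k = 0\<close>.\<close>

lemma tau_middle_bound:
  fixes n :: nat and k :: int
  assumes "\<beta> > 0" and "n \<ge> 1"
  shows "\<bar>tau \<beta> n k 0\<bar> \<le> 3 / 2 * \<bar>real_of_int k\<bar>"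
proof -
  define a b c where "a = tau \<beta> n k (-1)" and "b = tau \<beta> n k 0" and "c = tau \<beta> n k 1"
  define s where "s = (real_of_int k)\<^sup>2 + \<beta> * (2 * real n + 1)"
  have ord: "a < b" "b < c" using tau_roots(1,2)[OF assms] by (simp_all add: a_def b_def c_def)
  have v: "a + b + c = 0" "a * b + a * c + b * c = - s" "a * b * c = \<beta> * k"
    using tau_vieta[OF assms] by (simp_all add: a_def b_def c_def s_def)
  have \<beta>s: "\<beta> \<le> s"
    using mult_left_mono[of 1 "2 * real n + 1" \<beta>] assms by (simp add: s_def add_increasing)
  then have s0: "s > 0" using assms by simp
  have b: "b = - a - c" using v(1) by simp
  have "s - 3 * b\<^sup>2 = (b - a) * (c - b)"
    using v(2) unfolding b by algebra
  moreover have "(b - a) * (c - b) > 0" using ord by simp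
  ultimately have gap: "s - b\<^sup>2 \<ge> 2 / 3 * s" by simp
  have "b * (s - b\<^sup>2) = - (\<beta> * k)" using v by algebra
  then have "\<bar>b\<bar> * \<bar>s - b\<^sup>2\<bar> = \<beta> * \<bar>real_of_int k\<bar>"
    using assms by (simp flip: abs_mult add: abs_mult)
  moreover have "\<bar>b\<bar> * (2 / 3 * s) \<le> \<bar>b\<bar> * \<bar>s - b\<^sup>2\<bar>"
    using gap s0 by (intro mult_left_mono) (simp_all add: abs_if)
  moreover have "\<beta> * \<bar>real_of_int k\<bar> \<le> s * \<bar>real_of_int k\<bar>"
    using \<beta>s by (intro mult_right_mono) auto
  moreover have "\<bar>b\<bar> * (2 / 3 * s) = 2 / 3 * (s * \<bar>b\<bar>)"
    "s * (3 / 2 * \<bar>real_of_int k\<bar>) = 3 / 2 * (s * \<bar>real_of_int k\<bar>)"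
    by simp_all
  ultimately have "s * \<bar>b\<bar> \<le> s * (3 / 2 * \<bar>real_of_int k\<bar>)" by linarith
  then show ?thesis using s0 by (simp add: b_def)
qed

text \<open>Solving the root equation for its linear term gives
  \<open>\<tau> = \<tau>\<^sup>3 / s - \<beta> k / s\<close>; the uniform bound on
  \<open>\<tau>\<close> removes the first summand in the limit.\<close>

lemma tau_middle_limit:
  fixes n :: nat and k :: int
  assumes n: "n \<ge> 1"
  shows "((\<lambda>\<beta>. tau \<beta> n k 0) \<longlongrightarrow> - (k / (2 * real n + 1))) at_top"
proof -
  define N where "N = 2 * real n + 1"
  define s where "s \<beta> = (real_of_int k)\<^sup>2 + \<beta> * N" for \<beta> :: real
  have N: "N > 0" by (simp add: N_def)
  have "((\<lambda>\<beta>::real. \<beta> * k / s \<beta>) \<longlongrightarrow> k / N) at_top"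
    unfolding s_def using N by (real_asymp simp: field_simps)
  moreover have "((\<lambda>\<beta>. tau \<beta> n k 0 ^ 3 / s \<beta>) \<longlongrightarrow> 0) at_top"
  proof (rule tendsto_0_le[where K = 1])
    show "((\<lambda>\<beta>. (3 / 2 * \<bar>real_of_int k\<bar>) ^ 3 / s \<beta>) \<longlongrightarrow> 0) at_top"
      unfolding s_def using N by real_asymp
    show "\<forall>\<^sub>F \<beta> in at_top. norm (tau \<beta> n k 0 ^ 3 / s \<beta>)
        \<le> norm ((3 / 2 * \<bar>real_of_int k\<bar>) ^ 3 / s \<beta>) * 1"
      using eventually_gt_at_top[of 0]
    proof eventually_elim
      case (elim \<beta>)
      then have "s \<beta> > 0" using N by (simp add: s_def add_nonneg_pos)
      moreover have "\<bar>tau \<beta> n k 0\<bar> ^ 3 \<le> (3 / 2 * \<bar>real_of_int k\<bar>) ^ 3"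
        by (intro power_mono tau_middle_bound elim n) simp
      ultimately show ?case by (simp add: power_abs divide_right_mono)
    qed
  qed
  ultimately have "((\<lambda>\<beta>::real. tau \<beta> n k 0 ^ 3 / s \<beta> - \<beta> * k / s \<beta>) \<longlongrightarrow> 0 - k / N) at_top"
    by (intro tendsto_diff)
  moreover have "\<forall>\<^sub>F \<beta>::real in at_top. tau \<beta> n k 0 ^ 3 / s \<beta> - \<beta> * k / s \<beta> = tau \<beta> n k 0"
    using eventually_gt_at_top[of 0]
  proof eventually_elim
    case (elim \<beta>)
    then have "s \<beta> > 0" using N by (simp add: s_def add_nonneg_pos)
    moreover have "tau \<beta> n k 0 ^ 3 = s \<beta> * tau \<beta> n k 0 + \<beta> * k"
      using tau_root[OF elim n, of 0 k] by (simp add: s_def N_def)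
    ultimately show ?case by (simp flip: diff_divide_distrib)
  qed
  ultimately have "((\<lambda>\<beta>. tau \<beta> n k 0) \<longlongrightarrow> 0 - k / N) at_top"
    by (rule Lim_transform_eventually)
  then show ?thesis by (simp add: N_def)
qed

text \<open>The root equation is equivalent to
  \<open>s (\<tau> + k / N) = \<tau>\<^sup>3 + k\<^sup>3 / N\<close>. Multiplied by
  \<open>\<beta> / s\<close>, whose limit is \<open>1 / N\<close>, it turns the known limit of
  \<open>\<tau>\<close> into the coefficient of the next order.\<close>

lemma tau_middle_slow:
  fixes n :: nat and k :: int
  assumes n: "n \<ge> 1" and k: "k \<noteq> 0"
  shows "slow_branch (1 / (2 * real n + 1)) k (\<lambda>\<beta>. tau \<beta> n k 0)"
proof -
  define N where "N = 2 * real n + 1"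
  define s where "s \<beta> = (real_of_int k)\<^sup>2 + \<beta> * N" for \<beta> :: real
  have N: "N > 0" by (simp add: N_def)
  have "((\<lambda>\<beta>. \<beta> / s \<beta>) \<longlongrightarrow> 1 / N) at_top"
    unfolding s_def using N by (real_asymp simp: field_simps)
  then have lim: "((\<lambda>\<beta>. (\<beta> / s \<beta>) * (tau \<beta> n k 0 ^ 3 + k ^ 3 / N)) \<longlongrightarrow>
      1 / N * ((- (k / N)) ^ 3 + k ^ 3 / N)) at_top"
    using tau_middle_limit[OF n, of k, folded N_def]
    by (intro tendsto_mult[of "\<lambda>\<beta>. \<beta> / s \<beta>"] tendsto_add tendsto_power tendsto_const)
  have coeff: "1 / N * ((- (k / N)) ^ 3 + k ^ 3 / N) = k ^ 3 * ((1 / N)\<^sup>2 - (1 / N) ^ 4)"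
    by (simp add: algebra_simps power_divide eval_nat_numeral)
  have ev: "\<forall>\<^sub>F \<beta> in at_top. \<beta> / s \<beta> * (tau \<beta> n k 0 ^ 3 + k ^ 3 / N)
      = \<beta> * (tau \<beta> n k 0 + k * (1 / N))"
    using eventually_gt_at_top[of 0]
  proof eventually_elim
    case (elim \<beta>)
    then have s: "s \<beta> > 0" using N by (simp add: s_def add_nonneg_pos)
    have "tau \<beta> n k 0 ^ 3 + k ^ 3 / N = s \<beta> * tau \<beta> n k 0 + \<beta> * k + k ^ 3 / N"
      using tau_root[OF elim n, of 0 k] by (simp add: s_def N_def)
    also have "\<dots> = s \<beta> * (tau \<beta> n k 0 + k * (1 / N))"
      using N by (simp add: s_def field_simps power2_eq_square power3_eq_cube)
    finally show ?case using s by simp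
  qed
  have "((\<lambda>\<beta>. \<beta> * (tau \<beta> n k 0 + k * (1 / N))) \<longlongrightarrow>
      k ^ 3 * ((1 / N)\<^sup>2 - (1 / N) ^ 4)) at_top"
    using Lim_transform_eventually[OF lim ev] unfolding coeff .
  then show ?thesis
    using n k by (simp add: slow_branch_def N_def field_simps)
qed

text \<open>Multiplying by the sum of the two roots bounds the difference by
  \<open>\<bar>u b\<bar> / sqrt (c b)\<close>, whose numerator stays bounded.\<close>

lemma sqrt_perturbation:
  fixes u :: "real \<Rightarrow> real"
  assumes u: "(u \<longlongrightarrow> L) at_top" and c: "c > 0"
  shows "((\<lambda>b. sqrt (c * b + u b) - sqrt (c * b)) \<longlongrightarrow> 0) at_top"
proof (rule tendsto_0_le[where K = 1])
  have "((\<lambda>b::real. 1 / sqrt (c * b)) \<longlongrightarrow> 0) at_top" using c by real_asymp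
  from tendsto_mult[OF tendsto_rabs[OF u] this]
  show "((\<lambda>b. \<bar>u b\<bar> * (1 / sqrt (c * b))) \<longlongrightarrow> 0) at_top" by simp
  have "filterlim (\<lambda>b. u b + c * b) at_top at_top"
    using c by (intro filterlim_tendsto_add_at_top[OF u] filterlim_tendsto_pos_mult_at_top[OF tendsto_const])
      (simp_all add: filterlim_ident)
  then have "\<forall>\<^sub>F b in at_top. u b + c * b > 0" by (simp add: filterlim_at_top_dense)
  with eventually_gt_at_top[of 0]
  show "\<forall>\<^sub>F b in at_top. norm (sqrt (c * b + u b) - sqrt (c * b)) \<le> norm (\<bar>u b\<bar> * (1 / sqrt (c * b))) * 1"
  proof eventually_elim
    case (elim b)
    define x y where "x = sqrt (c * b + u b)" and "y = sqrt (c * b)"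
    have xy: "x > 0" "y > 0" using elim c by (simp_all add: x_def y_def add.commute)
    have "x\<^sup>2 = c * b + u b" "y\<^sup>2 = c * b" using elim c by (simp_all add: x_def y_def)
    then have "u b = (x - y) * (x + y)" by (simp add: power2_eq_square algebra_simps)
    then have "\<bar>u b\<bar> = \<bar>x - y\<bar> * (x + y)" using xy by (simp add: abs_mult)
    moreover have "\<bar>x - y\<bar> * y \<le> \<bar>x - y\<bar> * (x + y)" using xy by (intro mult_left_mono) auto
    ultimately have "\<bar>x - y\<bar> * y \<le> \<bar>u b\<bar>" by simp
    then have "norm (x - y) \<le> norm (\<bar>u b\<bar> * (1 / y)) * 1"
      using xy by (simp add: field_simps)
    then show ?case by (simp only: x_def y_def)
  qed
qed

text \<open>Every fast root comes from the quadratic formula. For \<open>n = 0\<close> one takes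
  \<open>t = k\<close> and \<open>u = k\<^sup>2\<close>; for \<open>n \<ge> 1\<close>,
  \<open>t\<close> is minus the middle root and \<open>u\<close> is \<open>4 k\<^sup>2\<close> minus
  three times its square.\<close>

lemma fast_branch_sqrt:
  fixes r t u :: "real \<Rightarrow> real"
  assumes N: "odd N" and \<sigma>: "\<sigma>\<^sup>2 = 1"
    and t: "(t \<longlongrightarrow> k / N) at_top" and u: "(u \<longlongrightarrow> L) at_top"
    and r: "\<And>b. b > 0 \<Longrightarrow> r b = t b / 2 + \<sigma> / 2 * sqrt (4 * real N * b + u b)"
  shows "fast_branch N \<sigma> k r"
proof -
  have N0: "real N > 0" using N by (auto intro: Nat.gr0I)
  have "((\<lambda>b. t b / 2 + \<sigma> / 2 * (sqrt (4 * real N * b + u b) - sqrt (4 * real N * b)))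
      \<longlongrightarrow> k / N / 2 + \<sigma> / 2 * 0) at_top"
    using N0 by (intro tendsto_intros t sqrt_perturbation[OF u]) auto
  moreover have "\<forall>\<^sub>F b in at_top. t b / 2 + \<sigma> / 2 * (sqrt (4 * real N * b + u b) - sqrt (4 * real N * b))
      = r b - \<sigma> * sqrt (b * real N)"
    using eventually_gt_at_top[of 0]
  proof eventually_elim
    case (elim b)
    have "sqrt (4 * real N * b) = 2 * sqrt (b * real N)"
      by (simp add: real_sqrt_mult)
    then show ?case by (simp add: r[OF elim] algebra_simps)
  qed
  ultimately have "((\<lambda>b. r b - \<sigma> * sqrt (b * real N)) \<longlongrightarrow> k / N / 2 + \<sigma> / 2 * 0) at_top"
    by (rule Lim_transform_eventually)
  then show ?thesis using N \<sigma> by (simp add: fast_branch_def mult.commute)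
qed

lemma tau_outer_fast:
  fixes n :: nat and k :: int
  assumes n: "n \<ge> 1" and j: "j \<in> {-1, 1}"
  shows "fast_branch (2 * n + 1) j k (\<lambda>\<beta>. tau \<beta> n k j)"
proof (rule fast_branch_sqrt)
  note t = tau_middle_limit[OF n, of k]
  show "((\<lambda>\<beta>. - tau \<beta> n k 0) \<longlongrightarrow> k / real (2 * n + 1)) at_top"
    using tendsto_minus[OF t] by (simp add: add.commute)
  show "((\<lambda>\<beta>. 4 * k\<^sup>2 - 3 * (tau \<beta> n k 0)\<^sup>2) \<longlongrightarrow> 4 * k\<^sup>2 - 3 * (- (k / (2 * real n + 1)))\<^sup>2) at_top"
    by (intro tendsto_intros t)
  fix \<beta> :: real assume \<beta>: "\<beta> > 0"
  define a b c where "a = tau \<beta> n k (-1)" and "b = tau \<beta> n k 0" and "c = tau \<beta> n k 1"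
  define s where "s = (real_of_int k)\<^sup>2 + \<beta> * (2 * real n + 1)"
  have ord: "a < c" using tau_roots(1,2)[OF \<beta> n, of k] by (simp add: a_def c_def)
  have v: "a + b + c = 0" "a * b + a * c + b * c = - s"
    using tau_vieta[OF \<beta> n] by (simp_all add: a_def b_def c_def s_def)
  have b: "b = - a - c" using v(1) by simp
  \<comment> \<open>Splitting off the middle root leaves a quadratic for \<open>a\<close> and
    \<open>c\<close> with sum \<open>- b\<close>; this is its discriminant.\<close>
  have "4 * s - 3 * b\<^sup>2 = (c - a)\<^sup>2" using v(2) unfolding b by algebra
  then have "sqrt (4 * s - 3 * b\<^sup>2) = c - a" using ord by simp
  moreover have "4 * s - 3 * b\<^sup>2 = 4 * real (2 * n + 1) * \<beta> + (4 * k\<^sup>2 - 3 * b\<^sup>2)"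
    by (simp add: s_def algebra_simps)
  ultimately have "sqrt (4 * real (2 * n + 1) * \<beta> + (4 * k\<^sup>2 - 3 * b\<^sup>2)) = c - a" by simp
  then show "tau \<beta> n k j = - tau \<beta> n k 0 / 2
      + j / 2 * sqrt (4 * real (2 * n + 1) * \<beta> + (4 * k\<^sup>2 - 3 * (tau \<beta> n k 0)\<^sup>2))"
    using j b unfolding b_def[symmetric] by (elim insertE) (simp_all add: a_def c_def diff_divide_distrib add_divide_distrib)
qed (use j in auto)

lemma tau_zero_fast:
  fixes k :: int
  assumes j: "j \<in> {-1, 1}"
  shows "fast_branch 1 j k (\<lambda>\<beta>. tau \<beta> 0 k j)"
proof (rule fast_branch_sqrt)
  show "((\<lambda>_. real_of_int k) \<longlongrightarrow> k / real 1) at_top" by simp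
  show "((\<lambda>_. (real_of_int k)\<^sup>2) \<longlongrightarrow> k\<^sup>2) at_top" by simp
  show "tau \<beta> 0 k j = k / 2 + j / 2 * sqrt (4 * real 1 * \<beta> + (real_of_int k)\<^sup>2)" for \<beta>
    using j by (auto simp: tau_def add.commute)
qed (use j in auto)

lemma tau_kelvin_slow:
  assumes "k \<noteq> 0"
  shows "slow_branch (-1) (real_of_int k) (\<lambda>\<beta>. tau \<beta> 0 k 0)"
  using assms by (simp add: slow_branch_def tau_def)

text \<open>The set \<open>I\<close> is closed under conjugation over the rational functions in \<open>\<beta>\<close>. It must leave out the
  label \<open>0\<close> when \<open>k = 0\<close>, since that root vanishes identically, and must separate the Kelvin mode from
  the other modes with \<open>n = 0\<close>.\<close>

lemma tau_conjugates:
  fixes n :: nat and k j :: int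
  assumes j: "j \<in> {-1, 0, 1}" and nz: "j \<noteq> 0 \<or> k \<noteq> 0"
  shows "\<exists>I. finite I \<and> j \<in> I \<and> polynomial_norms I (\<lambda>i \<beta>. tau \<beta> n k i) \<and>
    (\<forall>i\<in>I. branch (kelvin_mode n k j) k (\<lambda>\<beta>. tau \<beta> n k i))"
proof -
  have s: "polyfun3 (\<lambda>\<beta> _ _. (real_of_int k)\<^sup>2 + \<beta> * (2 * real n + 1))" and t: "polyfun3 (\<lambda>\<beta> _ _. \<beta> * k)"
    and q: "polyfun3 (\<lambda>\<beta> _ _. \<beta> * (2 * real n + 1))" and c: "polyfun3 (\<lambda>\<beta> _ _. k)"
    by (intro polyfun3_intros)+
  have outer: "branch K k (\<lambda>\<beta>. tau \<beta> n k i)" if "i \<in> {-1, 1}" for i K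
    using tau_outer_fast[of n i k] tau_zero_fast[of i k] that
    by (cases "n = 0") (auto simp: branch_def)
  consider (cubic) "n \<ge> 1" "k \<noteq> 0" | (kelvin) "n = 0" "j = 0" "k \<noteq> 0"
    | (poincare) "n = 0" "j \<noteq> 0" | (sqrt) "n \<ge> 1" "k = 0" "j \<noteq> 0"
    using nz by linarith
  then show ?thesis
  proof cases
    case cubic
    have "polynomial_norms {-1, 0, 1} (\<lambda>i \<beta>. tau \<beta> n k i)"
      by (rule polynomial_norms_cubic[OF s t]) (use tau_vieta cubic in auto)
    moreover have "branch K k (\<lambda>\<beta>. tau \<beta> n k 0)" for K
    proof -
      have "1 / (2 * real n + 1) \<noteq> -1" by (simp add: field_simps)
      then show ?thesis using tau_middle_slow[OF cubic] unfolding branch_def by (metis (no_types))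
    qed
    ultimately show ?thesis
      using outer j by (intro exI[of _ "{-1, 0, 1}"]) auto
  next
    case kelvin
    have "polynomial_norms {0} (\<lambda>i \<beta>. tau \<beta> n k i)"
      by (rule polynomial_norms_linear[where c = k]) (simp add: tau_def kelvin)
    moreover have "branch (kelvin_mode n k j) k (\<lambda>\<beta>. tau \<beta> n k 0)"
      using tau_kelvin_slow[of k] kelvin by (auto simp: branch_def kelvin_mode_def)
    ultimately show ?thesis using kelvin by (intro exI[of _ "{0}"]) auto
  next
    case poincare
    have "polynomial_norms {-1, 1} (\<lambda>i \<beta>. tau \<beta> n k i)"
    proof (rule polynomial_norms_quadratic[OF c q])
      fix \<beta> :: real assume "\<beta> > 0"
      then have "(sqrt ((real_of_int k)\<^sup>2 + 4 * \<beta>))\<^sup>2 = (real_of_int k)\<^sup>2 + 4 * \<beta>"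
        by (simp add: add_nonneg_nonneg)
      then show "tau \<beta> n k (-1) * tau \<beta> n k 1 = - (\<beta> * (2 * real n + 1))"
        by (simp add: tau_def poincare algebra_simps power2_eq_square)
    qed (simp_all add: tau_def poincare)
    then show ?thesis using outer j poincare by (intro exI[of _ "{-1, 1}"]) auto
  next
    case sqrt
    \<comment> \<open>For \<open>k = 0\<close> the cubic is
      \<open>\<tau> (\<tau>\<^sup>2 - \<beta> (2 n + 1))\<close>. Only the quadratic factor is kept,
      and the sum of its roots is \<open>0\<close>, which is \<open>k\<close>.\<close>
    have "polynomial_norms {-1, 1} (\<lambda>i \<beta>. tau \<beta> n k i)"
    proof (rule polynomial_norms_quadratic[OF c q])
      fix \<beta> :: real assume \<beta>: "\<beta> > 0"
      have "tau \<beta> n k 0 = 0" using tau_middle_bound[OF \<beta> sqrt(1), of k] sqrt(2) by simp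
      then show "tau \<beta> n k (-1) + tau \<beta> n k 1 = k"
        "tau \<beta> n k (-1) * tau \<beta> n k 1 = - (\<beta> * (2 * real n + 1))"
        using tau_vieta[OF \<beta> sqrt(1), of k] sqrt(2) by simp_all
    qed simp
    then show ?thesis using outer j sqrt by (intro exI[of _ "{-1, 1}"]) auto
  qed
qed

section \<open>Finitely many resonant \<open>\<beta>\<close> for each choice of labels, and
  countability\<close>

lemma tau_identically_zero: "\<beta> > 0 \<Longrightarrow> tau \<beta> n 0 0 = 0"
  using tau_middle_bound[of \<beta> n 0] by (cases "n = 0") (simp_all add: tau_def)

lemma finite_resonances:
  fixes n n' m :: nat and k k' j j' l :: int
  assumes j: "j \<in> {-1, 0, 1}" "j' \<in> {-1, 0, 1}" "l \<in> {-1, 0, 1}"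
    and kelvin: "\<not> (kelvin_mode n k j \<and> kelvin_mode n' k' j' \<and> kelvin_mode m (k + k') l)"
  shows "finite {\<beta>. \<beta> > 0 \<and> tau \<beta> n k j \<noteq> 0 \<and> tau \<beta> n' k' j' \<noteq> 0 \<and> tau \<beta> m (k + k') l \<noteq> 0 \<and>
    tau \<beta> n k j + tau \<beta> n' k' j' = tau \<beta> m (k + k') l}" (is "finite ?B")
proof (cases "(j \<noteq> 0 \<or> k \<noteq> 0) \<and> (j' \<noteq> 0 \<or> k' \<noteq> 0) \<and> (l \<noteq> 0 \<or> k + k' \<noteq> 0)")
  case False
  \<comment> \<open>One of the three labels then belongs to the root that vanishes for every
    \<open>\<beta> > 0\<close>.\<close>
  then have "?B = {}" using tau_identically_zero by auto
  then show ?thesis by (simp only: finite.emptyI)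
next
  case True
  obtain I where I: "finite I" "j \<in> I" "polynomial_norms I (\<lambda>i \<beta>. tau \<beta> n k i)"
    "\<And>i. i \<in> I \<Longrightarrow> branch (kelvin_mode n k j) k (\<lambda>\<beta>. tau \<beta> n k i)"
    using tau_conjugates[OF j(1)] True by meson
  obtain J where J: "finite J" "j' \<in> J" "polynomial_norms J (\<lambda>i \<beta>. tau \<beta> n' k' i)"
    "\<And>i. i \<in> J \<Longrightarrow> branch (kelvin_mode n' k' j') k' (\<lambda>\<beta>. tau \<beta> n' k' i)"
    using tau_conjugates[OF j(2)] True by meson
  obtain L where L: "finite L" "l \<in> L" "polynomial_norms L (\<lambda>i \<beta>. tau \<beta> m (k + k') i)"
    "\<And>i. i \<in> L \<Longrightarrow> branch (kelvin_mode m (k + k') l) (k + k') (\<lambda>\<beta>. tau \<beta> m (k + k') i)"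
    using tau_conjugates[OF j(3), of "k + k'" m] True by auto
  let ?F = "\<lambda>\<beta> i i' h. tau \<beta> n k i + tau \<beta> n' k' i' - tau \<beta> m (k + k') h"
  obtain p where p: "\<And>\<beta>. \<beta> > 0 \<Longrightarrow> poly p \<beta> = (\<Prod>i\<in>I. \<Prod>i'\<in>J. \<Prod>h\<in>L. ?F \<beta> i i' h)"
    using polynomial_norms_sum[OF I(3) J(3) L(3)] by blast
  \<comment> \<open>The third branch enters negated, with wave number \<open>- (k + k')\<close>. The
    flags depend on the fixed labels \<open>j\<close>, \<open>j'\<close>, \<open>l\<close> and not
    on the conjugates, so the assumption \<open>kelvin\<close> covers every factor.\<close>
  have "\<forall>\<^sub>F \<beta> in at_top. ?F \<beta> i i' h \<noteq> 0" if "i \<in> I" "i' \<in> J" "h \<in> L" for i i' h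
    using no_resonance[OF I(4)[OF that(1)] J(4)[OF that(2)] branch_uminus[OF L(4)[OF that(3)]]] kelvin
    by simp
  then have "\<forall>\<^sub>F \<beta> in at_top. \<forall>i\<in>I. \<forall>i'\<in>J. \<forall>h\<in>L. ?F \<beta> i i' h \<noteq> 0"
    using I(1) J(1) L(1) by (simp add: eventually_ball_finite_distrib)
  then have "\<forall>\<^sub>F \<beta> in at_top. \<beta> > 0 \<and> (\<forall>i\<in>I. \<forall>i'\<in>J. \<forall>h\<in>L. ?F \<beta> i i' h \<noteq> 0)"
    by (intro eventually_conj eventually_gt_at_top)
  then obtain \<beta>0 where "\<beta>0 > 0" "\<forall>i\<in>I. \<forall>i'\<in>J. \<forall>h\<in>L. ?F \<beta>0 i i' h \<noteq> 0"
    using eventually_happens by fastforce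
  then have "poly p \<beta>0 \<noteq> 0" using I(1) J(1) L(1) by (simp add: p prod_zero_iff)
  then have "p \<noteq> 0" by auto
  then have "finite {\<beta>. poly p \<beta> = 0}" by (rule poly_roots_finite)
  \<comment> \<open>A resonance annihilates the factor with the original labels \<open>j\<close>,
    \<open>j'\<close>, \<open>l\<close>, hence the whole product.\<close>
  moreover have "?B \<subseteq> {\<beta>. poly p \<beta> = 0}"
  proof clarify
    fix \<beta> :: real assume \<beta>: "\<beta> > 0" and e: "tau \<beta> n k j + tau \<beta> n' k' j' = tau \<beta> m (k + k') l"
    then have "?F \<beta> j j' l = 0" by simp
    then show "poly p \<beta> = 0"
      using I(1,2) J(1,2) L(1,2) unfolding p[OF \<beta>] prod_zero_iff[OF I(1)] prod_zero_iff[OF J(1)]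
        prod_zero_iff[OF L(1)] by blast
  qed
  ultimately show ?thesis by (rule finite_subset[rotated])
qed

theorem proposition2p4p1:
  "countable {\<beta> :: real. \<beta> > 0 \<and> \<not> (non_resonance \<beta> \<and> only_kelvin_interactions \<beta>)}"
proof -
  \<comment> \<open>Three Kelvin labels are left out because they resonate for every
    \<open>\<beta>\<close>: their eigenvalues are the wave numbers themselves.\<close>
  define T where "T = {(n, n', m, k, k', j, j', l).
    j \<in> {-1, 0, 1} \<and> j' \<in> {-1, 0, 1} \<and> l \<in> {-1, 0, 1} \<and>
    \<not> (kelvin_mode n k j \<and> kelvin_mode n' k' j' \<and> kelvin_mode m (k + k') l)}"
  define B where "B = (\<lambda>(n, n', m, k, k', j, j', l).
    {\<beta>. \<beta> > 0 \<and> tau \<beta> n k j \<noteq> 0 \<and> tau \<beta> n' k' j' \<noteq> 0 \<and> tau \<beta> m (k + k') l \<noteq> 0 \<and>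
      tau \<beta> n k j + tau \<beta> n' k' j' = tau \<beta> m (k + k') l})"
  have "countable (\<Union>t\<in>T. B t)"
  proof (rule countable_UN)
    show "countable T" by simp
    fix t assume "t \<in> T"
    then have "finite (B t)" by (auto simp: T_def B_def intro!: finite_resonances)
    then show "countable (B t)" by (rule countable_finite)
  qed
  moreover have "{\<beta>. \<beta> > 0 \<and> \<not> (non_resonance \<beta> \<and> only_kelvin_interactions \<beta>)} \<subseteq> (\<Union>t\<in>T. B t)"
  proof (rule subsetI, rule ccontr)
    fix \<beta> :: real
    assume "\<beta> \<in> {\<beta>. \<beta> > 0 \<and> \<not> (non_resonance \<beta> \<and> only_kelvin_interactions \<beta>)}"
      and outside: "\<beta> \<notin> (\<Union>t\<in>T. B t)"
    then have \<beta>: "\<beta> > 0" and bad: "\<not> (non_resonance \<beta> \<and> only_kelvin_interactions \<beta>)" by auto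
    have kelvin: "kelvin_mode n k j \<and> kelvin_mode n' k' j' \<and> kelvin_mode m (k + k') l"
      if "j \<in> {-1, 0, 1}" "j' \<in> {-1, 0, 1}" "l \<in> {-1, 0, 1}"
        "tau \<beta> n k j \<noteq> 0" "tau \<beta> n' k' j' \<noteq> 0" "tau \<beta> m (k + k') l \<noteq> 0"
        "tau \<beta> n k j + tau \<beta> n' k' j' = tau \<beta> m (k + k') l" for n n' m k k' j j' l
    proof (rule ccontr)
      assume "\<not> ?thesis"
      then have "(n, n', m, k, k', j, j', l) \<in> T" using that(1-3) by (simp add: T_def)
      moreover have "\<beta> \<in> B (n, n', m, k, k', j, j', l)" using that \<beta> by (simp add: B_def)
      ultimately show False using outside by blast
    qed
    \<comment> \<open>This passes from the condition on modes to the one on eigenvalues.\<close>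
    have spectrum: "tau \<beta> n k j \<in> kelvin_spectrum \<beta>" if "kelvin_mode n k j" for n k j
      using that by (auto simp: kelvin_mode_def kelvin_spectrum_def)
    have "only_kelvin_interactions \<beta>"
      unfolding only_kelvin_interactions_def using kelvin by blast
    moreover have "non_resonance \<beta>"
      unfolding non_resonance_def using kelvin spectrum by meson
    ultimately show False using bad by simp
  qed
  ultimately show ?thesis by (rule countable_subset[rotated])
qed

end
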